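(* Let the graded sequence $s_a^\alpha(x)$ be Sheffer for $g(D)$ with respect to the delta operator $f(D)$ (and $n$). Then for every $\alpha$ the following identity of formal series in $y$ holds. Discrete: $$\sum_{k}\frac{s_k^\alpha(x)}{\lfloor k\rceil!}\,y^k=g\big(f^{(-1)}(y)\big)\,[\exp]_\alpha\big(x f^{(-1)}(y)\big),\qquad [\exp]_\alpha\big(x f^{(-1)}(y)\big):=\sum_{k}\frac{\lambda_k^\alpha(x)}{\lfloor k\rceil!}\big(f^{(-1)}(y)\big)^k,$$ the sums running over all integers $k$. Continuous: $$\sum_{a}\frac{s_a^\alpha(x)}{\lfloor a\rceil!}\,y^a=g\big(f^{(-1;n)}(y)\big)\,[\exp]_\alpha^{\,xf^{(-1)}(y);n},\qquad [\exp]_\alpha^{\,xf^{(-1)}(y);n}:=\sum_{a}\frac{\lambda_a^\alpha(x)}{\lfloor a\rceil!}\big(f^{(-1;n)}(y)\big)^{a},$$ the sums running over all real $a$. (The right-hand sides are expanded in powers of $y$, by multiplying each summand by the series $g(f^{(-1)}(y))$, resp. $g(f^{(-1;n)}(y))$, and the coefficients, which lie in $\mathcal I^\alpha$, are collected.)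
   Context: Two interpretations. Discrete: indices $a,b,\dots$ are integers and $\alpha,\beta$ are finitely supported vectors $(\alpha_1,\alpha_2,\dots)$ of integers. Continuous: the indices are real numbers and $\alpha,\beta$ are finitely supported real vectors. $(0)$ is the zero vector. Coefficients are complex. Roman factorials: $\lfloor a\rceil!=\Gamma(a+1)$ if $a$ is not a negative integer, and $\lfloor a\rceil!=(-1)^{a+1}/(-a-1)!$ if $a$ is a negative integer. Logarithmic algebra: put $\ell^{(a),\alpha}=x^a(\log x)^{\alpha_1}(\log\log x)^{\alpha_2}\cdots$. $\mathcal I$ is the algebra of formal series in these monomials, ordered lexicographically (exponent of $x$ first), with reverse well-ordered support; $D=d/dx$ acts termwise. Harmonic logarithms: with $\delta=xD$ and the Taylor expansion $\Gamma(s+1)/\Gamma(s+a+1)=\sum_{k\ge0}c_k(a)s^k$ at $s=0$, put $\lambda_a^\alpha(x)=\lfloor a\rceil!\,x^a\sum_{k\ge0}c_k(a)\,\delta^k\ell^{(0),\alpha}$. Thus $\lambda_0^\alpha=\ell^{(0),\alpha}$; $\lambda_a^{(0)}=x^a$ if $a$ is not a negative integer and $\lambda_a^{(0)}=0$ if it is. $\mathcal I^\alpha$ is the space of series $\sum_a c_a\lambda_a^\alpha$ whose set of exponents $a$ with $c_a\ne0$ is reverse well-ordered (in the discrete case: integers bounded above); its degree is the largest such $a$. $\langle p\rangle_\alpha$ is the coefficient of $\lambda_0^\alpha$ in $p\in\mathcal I^\alpha$. Operators: for $\alpha\neq(0)$, $D^b\lambda_a^\alpha=\frac{\lfloor a\rceil!}{\lfloor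 a-b\rceil!}\lambda_{a-b}^\alpha$ for every index $b$. An Artinian operator is $g(D)=\sum_b g_bD^b$ with well-ordered support (in the discrete case, a Laurent series in $D$); its degree is the least $b$ with $g_b\ne0$. A delta operator is an Artinian operator of degree $1$. For $f(D)=cD(1+h(D))$ a delta operator, with $h$ having only positive exponents, and $n$ an integer, $f(D)^{b;n}=|c|^be^{ib(\arg c+2\pi n)}D^b\sum_{k\ge0}\binom bk h(D)^k$ with $-\pi<\arg c\le\pi$ (independent of $n$ for integer $b$). Compositional inverse: the substitution $y^a\mapsto f(D)^{a;n}$ extends to an isomorphism $\varphi_{f,n}$ from series in $y$ with well-ordered support to series in $D$ with well-ordered support; $(f^{(-1;n)}(y))^b:=\varphi_{f,n}^{-1}(D^b)$ and, for $g(D)=\sum_b g_bD^b$, $g(f^{(-1;n)}(y)):=\varphi_{f,n}^{-1}(g(D))=\sum_b g_b(f^{(-1;n)}(y))^b$. In the discrete case $n$ is irrelevant and $f^{(-1)}(y)$ is the usual compositional inverse of $f$. Graded sequence: a family $p_a^\alpha(x)\in\mathcal I^\alpha$ such that for $\alpha\ne(0)$ the degree of $p_a^\alpha$ is $a$, and which is regular: for every $\alpha\neq(0)$ and every $\beta$, replacing each $\lambda_b^\alpha$ by $\lambda_b^\beta$ in $p_a^\alpha$ gives $p_a^\beta$. The ($n$th) associated sequence of a delta operator $f(D)$ is the graded sequence with $\langle f(D)^{b;n}p_a^\alpha\rangle_\alpha=\lfloor a\rceil!\,\delta_{ab}$ for all $a,b$ and $\alpha\neq(0)$. A graded sequence $s_a^\alpha$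 is Sheffer for the Artinian operator $g(D)$ of degree $0$ with respect to $f(D)$ (and $n$) if $s_a^\alpha(x)=g(D)p_a^\alpha(x)$ for all $a$ and all $\alpha\ne(0)$, where $p_a^\alpha$ is the ($n$th) associated sequence of $f(D)$ (the members with $\alpha=(0)$ then being determined by regularity). *)

theory Defs
  imports "HOL-Complex_Analysis.Complex_Analysis" "HOL-Library.Poly_Mapping"
begin

text \<open>
  The discrete and the continuous interpretation share all definitions: the index type is
  \<open>int\<close> for the former and \<open>real\<close> for the latter.
\<close>

class log_index = linordered_idom +
  fixes to_real :: "'a \<Rightarrow> real"
  assumes to_real_add: "to_real (a + b) = to_real a + to_real b"
    and to_real_mult: "to_real (a * b) = to_real a * to_real b"
    and to_real_one: "to_real 1 = 1"
    and to_real_less: "to_real a < to_real b \<longleftrightarrow> a < b"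

instantiation int :: log_index
begin
definition to_real_int :: "int \<Rightarrow> real" where "to_real_int = real_of_int"
instance by standard (simp_all add: to_real_int_def)
end

instantiation real :: log_index
begin
definition to_real_real :: "real \<Rightarrow> real" where "to_real_real a = a"
instance by standard (simp_all add: to_real_real_def)
end

abbreviation to_complex :: "'i::log_index \<Rightarrow> complex" where
  "to_complex a \<equiv> complex_of_real (to_real a)"

definition roman_fact :: "'i::log_index \<Rightarrow> complex" where
  "roman_fact a =
     (if to_real a \<in> \<int> \<and> to_real a < 0
      then (-1) powi (\<lfloor>to_real a\<rfloor> + 1) / fact (nat (- \<lfloor>to_real a\<rfloor> - 1))
      else Gamma (to_complex a + 1))"


subsection \<open>Formal series\<close>

text \<open>
  A formal series is its coefficient function. A family of series is summed coefficientwise;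
  this is meaningful when every coefficient receives finitely many nonzero contributions
  (otherwise \<^const>\<open>sum\<close> returns the junk value 0).
\<close>

definition support :: "('k \<Rightarrow> complex) \<Rightarrow> 'k set" where
  "support p = {k. p k \<noteq> 0}"

definition basis :: "'k \<Rightarrow> 'k \<Rightarrow> complex" where
  "basis k = (\<lambda>k'. if k' = k then 1 else 0)"

definition formal_sum :: "('j \<Rightarrow> 'k \<Rightarrow> complex) \<Rightarrow> 'k \<Rightarrow> complex" where
  "formal_sum F = (\<lambda>k. \<Sum>j | F j k \<noteq> 0. F j k)"


subsection \<open>The logarithmic algebra\<close>

text \<open>
  The pair \<open>(a, \<alpha>)\<close> stands for the monomial
  \<open>x^a (log x)^\<alpha>\<^sub>1 (log log x)^\<alpha>\<^sub>2 \<dots>\<close>, where \<open>\<alpha>\<^sub>1, \<alpha>\<^sub>2, \<dots>\<close> are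
  \<open>lookup \<alpha> 0, lookup \<alpha> 1, \<dots>\<close>. The order of \<^typ>\<open>nat \<Rightarrow>\<^sub>0 'i::log_index\<close> from the
  library is lexicographic, smallest position first.
\<close>

type_synonym 'i log_mono = "'i \<times> (nat \<Rightarrow>\<^sub>0 'i)"
type_synonym 'i log_series = "'i log_mono \<Rightarrow> complex"

definition log_mono_less :: "'i::log_index log_mono \<Rightarrow> 'i log_mono \<Rightarrow> bool" where
  "log_mono_less m m' \<longleftrightarrow> fst m < fst m' \<or> fst m = fst m' \<and> snd m < snd m'"

definition log_algebra :: "'i::log_index log_series set" where
  "log_algebra = {p. wfp_on (support p) (\<lambda>m m'. log_mono_less m' m)}"

text \<open>
  Summability in \<^const>\<open>log_algebra\<close>: the sum is coefficientwise finite and stays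
  in the algebra whatever cancellations occur.
\<close>

definition log_summable :: "('j \<Rightarrow> 'i::log_index log_series) \<Rightarrow> bool" where
  "log_summable F \<longleftrightarrow>
     wfp_on (\<Union>j. support (F j)) (\<lambda>m m'. log_mono_less m' m) \<and> (\<forall>m. finite {j. F j m \<noteq> 0})"

text \<open>
  The derivative of \<open>log\<^sub>i x\<close> (\<open>i\<close>-fold logarithm) is
  \<open>1 / (x log x \<dots> log\<^sub>i\<^sub>-\<^sub>1 x)\<close>, so differentiating its \<open>\<alpha>\<^sub>i\<close>-th power
  lowers the exponents of \<open>x, log x, \<dots>, log\<^sub>i x\<close> by one each.
\<close>

definition log_shift :: "nat \<Rightarrow> (nat \<Rightarrow>\<^sub>0 'i::log_index)" where
  "log_shift i = (\<Sum>j\<le>i. Poly_Mapping.single j 1)"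

definition D_mono :: "'i::log_index log_mono \<Rightarrow> 'i log_series" where
  "D_mono = (\<lambda>(a, \<alpha>) m. to_complex a * basis (a - 1, \<alpha>) m +
     (\<Sum>i\<in>Poly_Mapping.keys \<alpha>.
        to_complex (Poly_Mapping.lookup \<alpha> i) * basis (a - 1, \<alpha> - log_shift i) m))"

definition log_D :: "'i::log_index log_series \<Rightarrow> 'i log_series" where
  "log_D p = formal_sum (\<lambda>m m'. p m * D_mono m m')"

definition mult_x :: "'i::log_index \<Rightarrow> 'i log_series \<Rightarrow> 'i log_series" where
  "mult_x a p = (\<lambda>(b, \<beta>). p (b - a, \<beta>))"

definition xD :: "'i::log_index log_series \<Rightarrow> 'i log_series" where
  "xD p = mult_x 1 (log_D p)"


subsection \<open>Harmonic logarithms\<close>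

text \<open>
  \<^term>\<open>rGamma\<close> is the entire function \<open>1 / \<Gamma>\<close>, so the expanded function is analytic at 0
  also if \<open>a\<close> is a negative integer.
\<close>

definition harm_coeff :: "'i::log_index \<Rightarrow> nat \<Rightarrow> complex" where
  "harm_coeff a k =
     fps_nth (fps_expansion (\<lambda>s. Gamma (s + 1) * rGamma (s + to_complex a + 1)) 0) k"

definition harm_log :: "'i::log_index \<Rightarrow> (nat \<Rightarrow>\<^sub>0 'i) \<Rightarrow> 'i log_series" where
  "harm_log a \<alpha> = (\<lambda>m. roman_fact a *
     mult_x a (formal_sum (\<lambda>k m'. harm_coeff a k * (xD ^^ k) (basis (0, \<alpha>)) m')) m)"

definition rev_artinian :: "('i::log_index \<Rightarrow> complex) \<Rightarrow> bool" where
  "rev_artinian c \<longleftrightarrow> wfp_on (support c) (>)"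

definition harm_comb :: "(nat \<Rightarrow>\<^sub>0 'i::log_index) \<Rightarrow> ('i \<Rightarrow> complex) \<Rightarrow> 'i log_series" where
  "harm_comb \<alpha> c = formal_sum (\<lambda>a m. c a * harm_log a \<alpha> m)"

definition log_space :: "(nat \<Rightarrow>\<^sub>0 'i::log_index) \<Rightarrow> 'i log_series set" where
  "log_space \<alpha> = {p \<in> log_algebra. \<exists>c. rev_artinian c \<and> p = harm_comb \<alpha> c}"

text \<open>
  For \<open>\<alpha> \<noteq> 0\<close> the coefficients are unique. For \<open>\<alpha> = 0\<close> those at negative integers are
  arbitrary, the corresponding harmonic logarithms being zero; the others are unique.
\<close>

definition harm_coords :: "(nat \<Rightarrow>\<^sub>0 'i::log_index) \<Rightarrow> 'i log_series \<Rightarrow> 'i \<Rightarrow> complex" where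
  "harm_coords \<alpha> = inv_into {c. rev_artinian c} (harm_comb \<alpha>)"

definition log_bracket :: "(nat \<Rightarrow>\<^sub>0 'i::log_index) \<Rightarrow> 'i log_series \<Rightarrow> complex" where
  "log_bracket \<alpha> p = harm_coords \<alpha> p 0"

definition has_log_degree ::
    "(nat \<Rightarrow>\<^sub>0 'i::log_index) \<Rightarrow> 'i log_series \<Rightarrow> 'i \<Rightarrow> bool" where
  "has_log_degree \<alpha> p a \<longleftrightarrow>
     harm_coords \<alpha> p a \<noteq> 0 \<and> (\<forall>b>a. harm_coords \<alpha> p b = 0)"


subsection \<open>Artinian operators\<close>

text \<open>
  An operator \<open>\<Sum>\<^sub>b g\<^sub>b D\<^sup>b\<close> and a series \<open>\<Sum>\<^sub>b g\<^sub>b y\<^sup>b\<close> are both represented by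
  \<open>\<lambda>b. g\<^sub>b\<close>; so \<^term>\<open>basis b\<close> is \<open>D\<^sup>b\<close>, resp. \<open>y\<^sup>b\<close>.
\<close>

definition artinian :: "('i::log_index \<Rightarrow> complex) \<Rightarrow> bool" where
  "artinian g \<longleftrightarrow> wfp_on (support g) (<)"

definition has_degree :: "('i::log_index \<Rightarrow> complex) \<Rightarrow> 'i \<Rightarrow> bool" where
  "has_degree g d \<longleftrightarrow> g d \<noteq> 0 \<and> (\<forall>b<d. g b = 0)"

definition delta_operator :: "('i::log_index \<Rightarrow> complex) \<Rightarrow> bool" where
  "delta_operator f \<longleftrightarrow> artinian f \<and> has_degree f 1"

definition art_mult ::
    "('i::log_index \<Rightarrow> complex) \<Rightarrow> ('i \<Rightarrow> complex) \<Rightarrow> 'i \<Rightarrow> complex" where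
  "art_mult g h = (\<lambda>c. \<Sum>a | g a \<noteq> 0 \<and> h (c - a) \<noteq> 0. g a * h (c - a))"

text \<open>
  \<open>D_pow\<close> and \<open>op_apply\<close> are only used for \<open>\<alpha> \<noteq> 0\<close> and arguments in
  \<^term>\<open>log_space \<alpha>\<close>.
\<close>

definition D_pow ::
    "(nat \<Rightarrow>\<^sub>0 'i::log_index) \<Rightarrow> 'i \<Rightarrow> 'i log_series \<Rightarrow> 'i log_series" where
  "D_pow \<alpha> b p = formal_sum (\<lambda>a m.
     harm_coords \<alpha> p a * (roman_fact a / roman_fact (a - b) * harm_log (a - b) \<alpha> m))"

definition op_apply ::
    "(nat \<Rightarrow>\<^sub>0 'i::log_index) \<Rightarrow> ('i \<Rightarrow> complex) \<Rightarrow> 'i log_series \<Rightarrow> 'i log_series" where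
  "op_apply \<alpha> g p = formal_sum (\<lambda>b m. g b * D_pow \<alpha> b p m)"

text \<open>The \<open>h\<close> in \<open>f(D) = c D (1 + h(D))\<close>, where \<open>c = f 1\<close>.\<close>

definition delta_tail :: "('i::log_index \<Rightarrow> complex) \<Rightarrow> 'i \<Rightarrow> complex" where
  "delta_tail f = (\<lambda>b. if b = 0 then 0 else f (b + 1) / f 1)"

definition delta_pow ::
    "int \<Rightarrow> ('i::log_index \<Rightarrow> complex) \<Rightarrow> 'i \<Rightarrow> 'i \<Rightarrow> complex" where
  "delta_pow n f b = (\<lambda>e.
     complex_of_real (cmod (f 1) powr to_real b) *
     exp (\<i> * to_complex b * complex_of_real (Arg (f 1) + 2 * pi * of_int n)) *
     formal_sum (\<lambda>k e'. (to_complex b gchoose k) *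
       (art_mult (delta_tail f) ^^ k) (basis 0) e') (e - b))"

definition delta_subst ::
    "int \<Rightarrow> ('i::log_index \<Rightarrow> complex) \<Rightarrow> ('i \<Rightarrow> complex) \<Rightarrow> 'i \<Rightarrow> complex" where
  "delta_subst n f u = formal_sum (\<lambda>a e. u a * delta_pow n f a e)"

text \<open>\<^term>\<open>subst_inverse n f g\<close> is the series \<open>g(f\<^sup>(\<^sup>-\<^sup>1\<^sup>;\<^sup>n\<^sup>)(y))\<close>.\<close>

definition subst_inverse ::
    "int \<Rightarrow> ('i::log_index \<Rightarrow> complex) \<Rightarrow> ('i \<Rightarrow> complex) \<Rightarrow> 'i \<Rightarrow> complex" where
  "subst_inverse n f = inv_into {u. artinian u} (delta_subst n f)"

definition inverse_pow ::
    "int \<Rightarrow> ('i::log_index \<Rightarrow> complex) \<Rightarrow> 'i \<Rightarrow> 'i \<Rightarrow> complex" where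
  "inverse_pow n f b = subst_inverse n f (basis b)"


subsection \<open>Graded, associated and Sheffer sequences\<close>

type_synonym 'i log_sequence = "'i \<Rightarrow> (nat \<Rightarrow>\<^sub>0 'i) \<Rightarrow> 'i log_series"

definition regular :: "'i::log_index log_sequence \<Rightarrow> bool" where
  "regular p \<longleftrightarrow> (\<forall>a \<alpha> \<beta>. \<alpha> \<noteq> 0 \<longrightarrow> p a \<beta> = harm_comb \<beta> (harm_coords \<alpha> (p a \<alpha>)))"

definition graded_sequence :: "'i::log_index log_sequence \<Rightarrow> bool" where
  "graded_sequence p \<longleftrightarrow>
     (\<forall>a \<alpha>. p a \<alpha> \<in> log_space \<alpha>) \<and>
     (\<forall>a \<alpha>. \<alpha> \<noteq> 0 \<longrightarrow> has_log_degree \<alpha> (p a \<alpha>) a) \<and>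
     regular p"

definition associated ::
    "int \<Rightarrow> ('i::log_index \<Rightarrow> complex) \<Rightarrow> 'i log_sequence \<Rightarrow> bool" where
  "associated n f p \<longleftrightarrow> graded_sequence p \<and>
     (\<forall>a b \<alpha>. \<alpha> \<noteq> 0 \<longrightarrow>
        log_bracket \<alpha> (op_apply \<alpha> (delta_pow n f b) (p a \<alpha>)) =
          (if a = b then roman_fact a else 0))"

definition sheffer ::
    "int \<Rightarrow> ('i::log_index \<Rightarrow> complex) \<Rightarrow> ('i \<Rightarrow> complex) \<Rightarrow> 'i log_sequence \<Rightarrow> bool" where
  "sheffer n f g s \<longleftrightarrow> graded_sequence s \<and>
     (\<exists>p. associated n f p \<and> (\<forall>a \<alpha>. \<alpha> \<noteq> 0 \<longrightarrow> s a \<alpha> = op_apply \<alpha> g (p a \<alpha>)))"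


subsection \<open>Formal series in y with logarithmic coefficients\<close>

text \<open>The coefficient of \<open>y\<^sup>b\<close> is the value at \<open>b\<close>; no support condition is imposed.\<close>

type_synonym 'i y_series = "'i \<Rightarrow> 'i log_series"

definition sequence_gf ::
    "'i::log_index log_sequence \<Rightarrow> (nat \<Rightarrow>\<^sub>0 'i) \<Rightarrow> 'i y_series" where
  "sequence_gf s \<alpha> = (\<lambda>a m. s a \<alpha> m / roman_fact a)"

definition exp_summand ::
    "int \<Rightarrow> ('i::log_index \<Rightarrow> complex) \<Rightarrow> (nat \<Rightarrow>\<^sub>0 'i) \<Rightarrow> 'i \<Rightarrow> 'i y_series" where
  "exp_summand n f \<alpha> a = (\<lambda>b m. harm_log a \<alpha> m / roman_fact a * inverse_pow n f a b)"

definition y_mult :: "('i::log_index \<Rightarrow> complex) \<Rightarrow> 'i y_series \<Rightarrow> 'i y_series" where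
  "y_mult G S = (\<lambda>b m. art_mult G (\<lambda>c. S c m) b)"

definition y_summable :: "('j \<Rightarrow> 'i::log_index y_series) \<Rightarrow> bool" where
  "y_summable F \<longleftrightarrow> (\<forall>b. log_summable (\<lambda>j. F j b))"

definition y_sum :: "('j \<Rightarrow> 'i::log_index y_series) \<Rightarrow> 'i y_series" where
  "y_sum F = (\<lambda>b. formal_sum (\<lambda>j. F j b))"

end

theory Submission
  imports Defs
begin

text \<open>
  Substituting the powers of \<open>f\<close> for those of \<open>y\<close> is multiplicative (Vandermonde) and
  surjective on Artinian series. For the associated sequence \<open>p\<close>, the functional that pairs an
  operator \<open>v(D)\<close> with \<open>p\<^sub>b\<close> is dual to the powers of \<open>f\<close>, so its value is the coefficient
  of \<open>y\<^sup>b\<close> in the preimage of \<open>v\<close>. The coordinate of \<open>s\<^sub>b = g(D) p\<^sub>b\<close> at \<open>\<lambda>\<^sub>e\<close> is, up to Roman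
  factorials, the pairing of \<open>g(D) D\<^sup>e\<close> with \<open>p\<^sub>b\<close>, hence the coefficient of \<open>y\<^sup>b\<close> in
  the product of the preimages of \<open>g(D)\<close> and \<open>D\<^sup>e\<close>. One nonzero \<open>\<alpha>\<close> suffices for this, by
  regularity, which also covers \<open>\<alpha> = 0\<close>. Summability of the right-hand side is then
  inherited from \<open>s\<^sub>b\<close> lying in the logarithmic algebra, because the summands have pairwise
  disjoint supports.
\<close>


section \<open>Well-ordered sets of indices\<close>

lemma wfp_on_less_sequence:
  fixes A :: "'a::linorder set"
  shows "wfp_on A (<) \<longleftrightarrow> \<not> (\<exists>x. \<forall>n::nat. x n \<in> A \<and> x (Suc n) < x n)"
proof -
  let ?R = "{(y, x) \<in> {(y, x). y < x}. y \<in> A \<and> x \<in> A}"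
  have "wfp_on A (<) \<longleftrightarrow> wf ?R"
    using wfp_on_wf_on_eq[of A "{(y, x). y < x}"] wf_on_iff_wf[of A "{(y, x). y < x}"]
    by (simp only: mem_Collect_eq prod.case)
  moreover have "(\<forall>n. (x (Suc n), x n) \<in> ?R) \<longleftrightarrow> (\<forall>n. x n \<in> A \<and> x (Suc n) < x n)" for x
    by (simp only: mem_Collect_eq prod.case) blast
  ultimately show ?thesis
    by (simp only: wf_iff_no_infinite_down_chain)
qed

lemma wfp_on_less_no_descent:
  fixes A :: "'a::linorder set" and x :: "nat \<Rightarrow> 'a"
  assumes "wfp_on A (<)" and "\<And>n. x n \<in> A" and "\<And>n. x (Suc n) < x n"
  shows False
proof -
  have "\<exists>x. \<forall>n::nat. x n \<in> A \<and> x (Suc n) < x n"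
    by (rule exI[of _ x]) (simp add: assms(2,3))
  then show False
    using assms(1) by (simp only: wfp_on_less_sequence not_True_eq_False)
qed

text \<open>Repeatedly pick a position where the remaining tail of the sequence attains its minimum.
  This replaces an arbitrary sequence by a weakly increasing one in the arguments below.\<close>

lemma wfp_on_less_monoseq_subsequence:
  fixes x :: "nat \<Rightarrow> 'a::linorder"
  assumes "wfp_on A (<)" and "\<And>n. x n \<in> A"
  shows "\<exists>r :: nat \<Rightarrow> nat. strict_mono r \<and> (\<forall>m n. m \<le> n \<longrightarrow> x (r m) \<le> x (r n))"
proof -
  have min: "\<exists>p\<ge>k. \<forall>m\<ge>k. x p \<le> x m" for k
  proof -
    have "x ` {k..} \<subseteq> A" "x ` {k..} \<noteq> {}"
      using assms(2) by auto
    then obtain y where "y \<in> x ` {k..}" "\<And>u. u < y \<Longrightarrow> u \<notin> x ` {k..}"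
      using assms(1) unfolding wfp_on_iff_ex_minimal by meson
    then show ?thesis
      by (metis atLeast_iff image_iff linorder_not_less)
  qed
  then obtain p where p: "\<And>k. p k \<ge> k" "\<And>k m. m \<ge> k \<Longrightarrow> x (p k) \<le> x m"
    by metis
  define r where "r = rec_nat (p 0) (\<lambda>_ q. p (Suc q))"
  have r: "r (Suc n) = p (Suc (r n))" for n
    by (simp add: r_def)
  have mono: "strict_mono r"
    unfolding strict_mono_Suc_iff r by (metis Suc_le_lessD p(1))
  have "\<exists>k. r n = p k" for n
    by (cases n) (auto simp: r r_def)
  then have "x (r n) \<le> x m" if "r n \<le> m" for n m
    using p(2) that by (metis le_trans p(1))
  then have "x (r m) \<le> x (r n)" if "m \<le> n" for m n
    using mono that by (simp add: strict_mono_less_eq)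
  with mono show ?thesis
    by blast
qed

text \<open>An injective sequence in an infinite set would have a weakly, hence strictly, increasing
  subsequence, against well-foundedness of the reversed order.\<close>

lemma finite_if_wfp_on_less_greater:
  fixes A :: "'a::linorder set"
  assumes "wfp_on A (<)" and "wfp_on A (>)"
  shows "finite A"
proof (rule ccontr)
  assume "infinite A"
  then obtain x :: "nat \<Rightarrow> 'a" where x: "inj x" "range x \<subseteq> A"
    using infinite_countable_subset by blast
  obtain r :: "nat \<Rightarrow> nat" where r: "strict_mono r" "\<And>m n. m \<le> n \<Longrightarrow> x (r m) \<le> x (r n)"
    using wfp_on_less_monoseq_subsequence[OF assms(1), of x] x(2) by (auto simp: image_subset_iff)
  have less: "x (r n) < x (r (Suc n))" for n
  proof -
    have "r n \<noteq> r (Suc n)"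
      using r(1) by (simp add: strict_mono_eq)
    then have "x (r n) \<noteq> x (r (Suc n))"
      using x(1) by (simp add: inj_eq)
    then show ?thesis
      using r(2)[of n "Suc n"] by (simp add: order_less_le)
  qed
  have "range (x \<circ> r) \<subseteq> A" "range (x \<circ> r) \<noteq> {}"
    using x(2) by auto
  then obtain z where "z \<in> range (x \<circ> r)" "\<And>y. z < y \<Longrightarrow> y \<notin> range (x \<circ> r)"
    using assms(2) unfolding wfp_on_iff_ex_minimal by meson
  then show False
    using less by auto
qed

text \<open>Along a subsequence on which the \<open>A\<close>-parts increase weakly, a strictly
  descending sequence of sums forces the \<open>B\<close>-parts to descend strictly.\<close>

lemma wfp_on_less_plus:
  fixes A B :: "'a::linordered_ab_group_add set"
  assumes A: "wfp_on A (<)" and B: "wfp_on B (<)"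
  shows "wfp_on (A + B) (<)"
  unfolding wfp_on_less_sequence
proof
  assume "\<exists>x. \<forall>n::nat. x n \<in> A + B \<and> x (Suc n) < x n"
  then obtain x where x: "\<And>n::nat. x n \<in> A + B" "\<And>n. x (Suc n) < x n"
    by blast
  then obtain a b where ab: "\<And>n. a n \<in> A" "\<And>n. b n \<in> B" "\<And>n. x n = a n + b n"
    unfolding set_plus_def by (simp, metis)
  obtain r :: "nat \<Rightarrow> nat" where r: "strict_mono r" "\<And>m n. m \<le> n \<Longrightarrow> a (r m) \<le> a (r n)"
    using wfp_on_less_monoseq_subsequence[OF A, of a] ab(1) by auto
  have dec: "x n < x m" if "m < n" for m n
    using that x(2) by (metis lift_Suc_mono_less[of "\<lambda>n. - x n"] neg_less_iff_less)
  have "b (r (Suc n)) < b (r n)" for n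
  proof -
    have "x (r (Suc n)) < x (r n)"
      using r(1) by (intro dec) (simp add: strict_mono_less)
    moreover have "a (r n) \<le> a (r (Suc n))"
      by (simp add: r(2))
    ultimately show ?thesis
      unfolding ab(3) by (meson add_le_less_mono add_mono leD le_less_linear)
  qed
  then show False
    by (rule wfp_on_less_no_descent[OF B ab(2)])
qed

lemma wfp_on_greater_uminus:
  fixes A :: "'a::linordered_ab_group_add set"
  shows "wfp_on A (>) \<longleftrightarrow> wfp_on (uminus ` A) (<)"
  unfolding wfp_on_image by simp

text \<open>The reflection at \<open>c\<close> reverses the order, so the set is well-ordered in
  both directions. This makes the convolution of two Artinian series finite in each
  coefficient.\<close>

lemma finite_sum_decompositions:
  fixes A B :: "'a::linordered_ab_group_add set"
  assumes "wfp_on A (<)" and "wfp_on B (<)"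
  shows "finite {a \<in> A. c - a \<in> B}"
proof (rule finite_if_wfp_on_less_greater)
  let ?S = "{a \<in> A. c - a \<in> B}"
  show "wfp_on ?S (<)"
    using assms(1) by (rule wfp_on_subset) blast
  have "wfp_on ((\<lambda>a. c - a) ` ?S) (<)"
    using assms(2) by (rule wfp_on_subset) blast
  then show "wfp_on ?S (>)"
    unfolding wfp_on_image by simp
qed

lemma wfp_on_less_Un:
  fixes A B :: "'a::linorder set"
  assumes "wfp_on A (<)" and "wfp_on B (<)"
  shows "wfp_on (A \<union> B) (<)"
  unfolding wfp_on_iff_ex_minimal
proof (intro allI impI)
  fix C assume C: "C \<subseteq> A \<union> B" "C \<noteq> {}"
  have *: "\<exists>z\<in>C \<inter> S. \<forall>y\<in>C \<inter> S. z \<le> y" if "wfp_on S (<)" and "C \<inter> S \<noteq> {}" for S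
    using that unfolding wfp_on_iff_ex_minimal
    by (metis inf_le2 linorder_not_less)
  consider "C \<inter> A = {}" | "C \<inter> B = {}" | "C \<inter> A \<noteq> {}" "C \<inter> B \<noteq> {}"
    by blast
  then have "\<exists>z\<in>C. \<forall>y\<in>C. z \<le> y"
  proof cases
    case 3
    then obtain a b where a: "a \<in> C \<inter> A" "\<forall>y\<in>C \<inter> A. a \<le> y" and b: "b \<in> C \<inter> B" "\<forall>y\<in>C \<inter> B. b \<le> y"
      using *[OF assms(1)] *[OF assms(2)] by blast
    then have "min a b \<in> C"
      by (simp add: min_def)
    moreover have "\<forall>y\<in>C. min a b \<le> y"
      using C(1) a(2) b(2) by (auto simp: min_le_iff_disj)
    ultimately show ?thesis
      by blast
  next
    case 1
    then have "C \<inter> B = C"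
      using C(1) by blast
    then show ?thesis
      using *[OF assms(2)] C(2) by simp
  next
    case 2
    then have "C \<inter> A = C"
      using C(1) by blast
    then show ?thesis
      using *[OF assms(1)] C(2) by simp
  qed
  then show "\<exists>z\<in>C. \<forall>y. y < z \<longrightarrow> y \<notin> C"
    by (meson linorder_not_less)
qed

lemma wfp_on_less_UN:
  fixes A :: "'k \<Rightarrow> 'a::linorder set"
  assumes "finite K" and "\<And>k. k \<in> K \<Longrightarrow> wfp_on (A k) (<)"
  shows "wfp_on (\<Union>k\<in>K. A k) (<)"
  using assms
proof (induction K rule: finite_induct)
  case empty
  then show ?case by (simp add: wfp_on_iff_ex_minimal)
next
  case (insert k K)
  then show ?case by (simp add: wfp_on_less_Un)
qed

text \<open>A descending sequence stays below its first member, hence inside one initial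
  segment.\<close>

lemma wfp_on_less_if_initial_segments:
  fixes A :: "'a::linorder set"
  assumes "\<And>e. wfp_on (A \<inter> {..e}) (<)"
  shows "wfp_on A (<)"
  unfolding wfp_on_less_sequence
proof
  assume "\<exists>x. \<forall>n::nat. x n \<in> A \<and> x (Suc n) < x n"
  then obtain x where x: "\<And>n::nat. x n \<in> A" "\<And>n. x (Suc n) < x n"
    by blast
  have "decseq x"
    using x(2) by (simp add: decseq_SucI less_imp_le)
  then have "\<And>n. x n \<in> A \<inter> {..x 0}"
    using x(1) by (simp add: decseqD)
  then show False
    by (rule wfp_on_less_no_descent[of _ x, OF assms _ x(2)])
qed


subsection \<open>The monoid generated by a well-ordered set of positive indices\<close>

text \<open>The \<open>k\<close>-fold sumset. With \<open>A\<close> the support of \<open>h\<close>,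
  it bounds the support of the \<open>k\<close>-th power of \<open>h\<close>.\<close>

definition list_sums :: "'a::monoid_add set \<Rightarrow> nat \<Rightarrow> 'a set" where
  "list_sums A k = {sum_list xs |xs. set xs \<subseteq> A \<and> length xs = k}"

definition gen_monoid :: "'a::monoid_add set \<Rightarrow> 'a set" where
  "gen_monoid A = (\<Union>k. list_sums A k)"

lemma list_sums_0 [simp]: "list_sums A 0 = {0}"
  by (auto simp: list_sums_def)

lemma list_sums_Suc: "list_sums A (Suc k) = A + list_sums A k"
proof -
  have "x \<in> list_sums A (Suc k) \<longleftrightarrow> (\<exists>a\<in>A. \<exists>y\<in>list_sums A k. x = a + y)" for x
  proof
    assume "x \<in> list_sums A (Suc k)"
    then obtain a xs where "x = a + sum_list xs" "a \<in> A" "set xs \<subseteq> A" "length xs = k"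
      by (auto simp: list_sums_def length_Suc_conv)
    then show "\<exists>a\<in>A. \<exists>y\<in>list_sums A k. x = a + y"
      unfolding list_sums_def by blast
  next
    assume "\<exists>a\<in>A. \<exists>y\<in>list_sums A k. x = a + y"
    then obtain a xs where "x = a + sum_list xs" "a \<in> A" "set xs \<subseteq> A" "length xs = k"
      by (auto simp: list_sums_def)
    then show "x \<in> list_sums A (Suc k)"
      by (auto simp: list_sums_def intro!: exI[of _ "a # xs"])
  qed
  then show ?thesis
    by (auto simp: set_plus_def)
qed

lemma wfp_on_list_sums:
  fixes A :: "'a::linordered_ab_group_add set"
  assumes "wfp_on A (<)"
  shows "wfp_on (list_sums A k) (<)"
proof (induction k)
  case 0
  then show ?case by (auto simp: wfp_on_iff_ex_minimal)
next
  case (Suc k)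
  with assms show ?case by (simp add: list_sums_Suc wfp_on_less_plus)
qed

lemma zero_in_gen_monoid: "0 \<in> gen_monoid A"
  by (auto simp: gen_monoid_def intro: exI[of _ 0])

lemma gen_monoid_add:
  assumes "x \<in> gen_monoid A" and "y \<in> gen_monoid A"
  shows "x + y \<in> gen_monoid A"
proof -
  obtain xs ys where "set xs \<subseteq> A" "x = sum_list xs" "set ys \<subseteq> A" "y = sum_list ys"
    using assms by (auto simp: gen_monoid_def list_sums_def)
  then have "set (xs @ ys) \<subseteq> A" "x + y = sum_list (xs @ ys)"
    by auto
  then show ?thesis
    unfolding gen_monoid_def list_sums_def by blast
qed

section \<open>The Archimedean bound on the number of summands\<close>

lemma to_real_zero [simp]: "to_real 0 = 0"
  using to_real_add[of 0 0] by simp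

lemma to_real_le: "to_real a \<le> to_real b \<longleftrightarrow> a \<le> b"
  by (metis linorder_not_less to_real_less)

text \<open>
  The index type is Archimedean, so the least generator bounds the number of summands.
\<close>

lemma list_sums_length_bound:
  fixes A :: "'i::log_index set"
  assumes "wfp_on A (<)" and "\<And>a. a \<in> A \<Longrightarrow> 0 < a"
  obtains K where "\<And>k x. x \<in> list_sums A k \<Longrightarrow> x \<le> e \<Longrightarrow> k \<le> K"
proof (cases "A = {}")
  case True
  then have "k \<le> 0" if "x \<in> list_sums A k" for k x
    using that by (auto simp: list_sums_def)
  then show thesis
    using that by blast
next
  case False
  then obtain d where d: "d \<in> A" "\<And>a. a \<in> A \<Longrightarrow> d \<le> a"
    using assms(1) unfolding wfp_on_iff_ex_minimal by (meson linorder_not_less order_refl)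
  have pos: "to_real d > 0"
    using assms(2)[OF d(1)] to_real_less[of 0 d] by simp
  have lower: "of_nat (length xs) * to_real d \<le> to_real (sum_list xs)" if "set xs \<subseteq> A" for xs
    using that
  proof (induction xs)
    case (Cons x xs)
    then have "to_real d \<le> to_real x"
      by (simp add: d(2) to_real_le)
    with Cons show ?case
      by (simp add: to_real_add algebra_simps)
  qed simp
  have "k \<le> nat \<lceil>to_real e / to_real d\<rceil>" if "x \<in> list_sums A k" "x \<le> e" for k x
  proof -
    have "of_nat k * to_real d \<le> to_real x"
      using that(1) lower by (auto simp: list_sums_def)
    also have "\<dots> \<le> to_real e"
      using that(2) by (simp add: to_real_le)
    finally have "real k \<le> to_real e / to_real d"
      using pos by (simp add: field_simps)
    then show ?thesis
      by linarith
  qed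
  then show thesis
    using that by blast
qed

text \<open>Below a fixed \<open>e\<close> only boundedly many summands can occur, so each initial
  segment lies in a finite union of well-ordered sumsets.\<close>

lemma wfp_on_gen_monoid:
  fixes A :: "'i::log_index set"
  assumes "wfp_on A (<)" and "\<And>a. a \<in> A \<Longrightarrow> 0 < a"
  shows "wfp_on (gen_monoid A) (<)"
proof (rule wfp_on_less_if_initial_segments)
  fix e
  obtain K where K: "\<And>k x. x \<in> list_sums A k \<Longrightarrow> x \<le> e \<Longrightarrow> k \<le> K"
    using list_sums_length_bound[OF assms] by blast
  have "wfp_on (\<Union>k\<in>{..K}. list_sums A k) (<)"
    by (intro wfp_on_less_UN wfp_on_list_sums assms(1)) simp
  then show "wfp_on (gen_monoid A \<inter> {..e}) (<)"
    by (rule wfp_on_subset) (use K in \<open>auto simp: gen_monoid_def\<close>)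
qed

lemma gen_monoid_nonneg:
  fixes A :: "'i::log_index set"
  assumes "\<And>a. a \<in> A \<Longrightarrow> 0 < a" and "x \<in> gen_monoid A"
  shows "0 \<le> x"
  proof -
  obtain xs where "set xs \<subseteq> A" "x = sum_list xs"
    using assms(2) by (auto simp: gen_monoid_def list_sums_def)
  then show ?thesis
    using assms(1) by (metis less_imp_le subset_iff sum_list_nonneg)
qed


section \<open>Coefficientwise sums\<close>

text \<open>For nonzero \<open>r\<close> both sides have the same set of nonzero terms, so the rule
  also covers infinite families, where \<open>Sum_any\<close> takes its default value 0.\<close>

lemma Sum_any_mult_left:
  fixes r :: "'a::semiring_no_zero_divisors"
  shows "Sum_any (\<lambda>n. r * g n) = r * Sum_any g"
  by (cases "r = 0") (simp_all add: Sum_any.expand_set sum_distrib_left)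

lemma Sum_any_mult_right:
  fixes r :: "'a::semiring_no_zero_divisors"
  shows "Sum_any (\<lambda>n. g n * r) = Sum_any g * r"
  by (cases "r = 0") (simp_all add: Sum_any.expand_set sum_distrib_right)

lemma Sum_any_single:
  assumes "\<And>j. j \<noteq> i \<Longrightarrow> g j = 0"
  shows "Sum_any g = g i"
proof -
  have "{j. g j \<noteq> 0} \<subseteq> {i}"
    using assms by blast
  then show ?thesis
    by (subst Sum_any.expand_superset[of "{i}"]) simp_all
qed

lemma Sum_any_plus_reindex:
  fixes a :: "'a::group_add"
  shows "Sum_any (\<lambda>d. g d) = Sum_any (\<lambda>b. g (a + b))"
proof (rule Sum_any.reindex_cong)
  show "bij ((+) a)"
    by (rule bij_betw_byWitness[of _ "\<lambda>b. - a + b"]) (auto simp: add.assoc[symmetric])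
qed (simp add: fun_eq_iff)

text \<open>Used to pass from a pair \<open>(k, l)\<close> to \<open>(k, k + l)\<close>; the shift
  on naturals is not onto, hence the padding by zeros.\<close>

lemma Sum_any_nat_shift:
  fixes x :: "nat \<Rightarrow> 'a::comm_monoid_add"
  shows "Sum_any x = Sum_any (\<lambda>m. if k \<le> m then x (m - k) else 0)"
proof -
  have "{m. (if k \<le> m then x (m - k) else 0) \<noteq> 0} = (+) k ` {l. x l \<noteq> 0}"
  proof (intro set_eqI iffI)
    fix m assume "m \<in> {m. (if k \<le> m then x (m - k) else 0) \<noteq> 0}"
    then have "k \<le> m" "x (m - k) \<noteq> 0"
      by (auto split: if_splits)
    then show "m \<in> (+) k ` {l. x l \<noteq> 0}"
      by (intro image_eqI[of _ _ "m - k"]) auto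
  qed auto
  then show ?thesis
    by (simp add: Sum_any.expand_set sum.reindex)
qed

lemma Sum_any_swap:
  assumes "finite {(a, b). g a b \<noteq> 0}"
  shows "Sum_any (\<lambda>a. Sum_any (\<lambda>b. g a b)) = Sum_any (\<lambda>b. Sum_any (\<lambda>a. g a b))"
proof (rule Sum_any.swap)
  let ?S = "{(a, b). g a b \<noteq> 0}"
  show "finite (fst ` ?S \<times> snd ` ?S)"
    using assms by simp
  show "{a. \<exists>b. g a b \<noteq> 0} \<times> {b. \<exists>a. g a b \<noteq> 0} \<subseteq> fst ` ?S \<times> snd ` ?S"
    by force
qed

lemma Sum_any_rotate:
  assumes "finite {(a, b, c). g a b c \<noteq> 0}"
  shows "Sum_any (\<lambda>a. Sum_any (\<lambda>b. Sum_any (\<lambda>c. g a b c))) =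
    Sum_any (\<lambda>b. Sum_any (\<lambda>c. Sum_any (\<lambda>a. g a b c)))"
proof -
  let ?S = "{(a, b, c). g a b c \<noteq> 0}"
  have "{(a, b). Sum_any (\<lambda>c. g a b c) \<noteq> 0} \<subseteq> (\<lambda>(a, b, c). (a, b)) ` ?S"
    by (force elim: Sum_any.not_neutral_obtains_not_neutral)
  then have "finite {(a, b). Sum_any (\<lambda>c. g a b c) \<noteq> 0}"
    using assms finite_surj by blast
  then have "Sum_any (\<lambda>a. Sum_any (\<lambda>b. Sum_any (\<lambda>c. g a b c))) =
      Sum_any (\<lambda>b. Sum_any (\<lambda>a. Sum_any (\<lambda>c. g a b c)))"
    by (rule Sum_any_swap)
  moreover have "Sum_any (\<lambda>a. Sum_any (\<lambda>c. g a b c)) = Sum_any (\<lambda>c. Sum_any (\<lambda>a. g a b c))" for b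
  proof (rule Sum_any_swap)
    have "{(a, c). g a b c \<noteq> 0} \<subseteq> (\<lambda>(a, b, c). (a, c)) ` ?S"
      by force
    then show "finite {(a, c). g a b c \<noteq> 0}"
      using assms finite_surj by blast
  qed
  ultimately show ?thesis
    by simp
qed

lemma formal_sum_Sum_any: "formal_sum F k = Sum_any (\<lambda>j. F j k)"
  by (simp add: formal_sum_def Sum_any.expand_set)

lemma art_mult_Sum_any: "art_mult g h c = Sum_any (\<lambda>a. g a * h (c - a))"
  by (simp add: art_mult_def Sum_any.expand_set)


section \<open>Artinian series\<close>

lemma in_support [simp]: "k \<in> support p \<longleftrightarrow> p k \<noteq> 0"
  by (simp add: support_def)

lemma support_art_mult: "support (art_mult g h) \<subseteq> support g + support h"
proof
  fix c assume "c \<in> support (art_mult g h)"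
  then have "Sum_any (\<lambda>a. g a * h (c - a)) \<noteq> 0"
    by (simp add: art_mult_Sum_any)
  then obtain a where "g a * h (c - a) \<noteq> 0"
    by (rule Sum_any.not_neutral_obtains_not_neutral)
  then have "a \<in> support g" "c - a \<in> support h" "c = a + (c - a)"
    by auto
  then show "c \<in> support g + support h"
    unfolding set_plus_def by blast
qed

lemma artinian_art_mult:
  assumes "artinian g" and "artinian h"
  shows "artinian (art_mult g h)"
  using wfp_on_subset[OF wfp_on_less_plus support_art_mult] assms
  by (simp add: artinian_def)

lemma support_basis: "support (basis b) = {b}"
  by (auto simp: basis_def split: if_splits)

lemma artinian_basis: "artinian (basis b)"
  by (auto simp: artinian_def support_basis wfp_on_iff_ex_minimal)

lemma art_mult_basis_left: "art_mult (basis b) g c = g (c - b)"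
proof -
  have "art_mult (basis b) g c = basis b b * g (c - b)"
    unfolding art_mult_Sum_any by (rule Sum_any_single) (simp add: basis_def)
  then show ?thesis
    by (simp add: basis_def)
qed

lemma art_mult_basis_right: "art_mult g (basis b) c = g (c - b)"
proof -
  have "art_mult g (basis b) c = g (c - b) * basis b (c - (c - b))"
    unfolding art_mult_Sum_any by (rule Sum_any_single) (auto simp: basis_def)
  then show ?thesis
    by (simp add: basis_def)
qed

lemma art_mult_assoc:
  assumes "artinian g" and "artinian h" and "artinian k"
  shows "art_mult (art_mult g h) k = art_mult g (art_mult h k)"
proof
  fix c
  have fin: "finite {(d, a). g a * h (d - a) * k (c - d) \<noteq> 0}"
  proof (rule finite_subset)
    show "{(d, a). g a * h (d - a) * k (c - d) \<noteq> 0} \<subseteq>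
        Sigma {d \<in> support g + support h. c - d \<in> support k} (\<lambda>d. {a \<in> support g. d - a \<in> support h})"
    proof clarsimp
      fix d a assume "g a \<noteq> 0" "h (d - a) \<noteq> 0"
      then show "d \<in> support g + support h"
        using set_plus_intro[of a "support g" "d - a" "support h"] by simp
    qed
    show "finite (Sigma {d \<in> support g + support h. c - d \<in> support k} (\<lambda>d. {a \<in> support g. d - a \<in> support h}))"
      using assms unfolding artinian_def
      by (intro finite_SigmaI finite_sum_decompositions wfp_on_less_plus)
  qed
  have "art_mult (art_mult g h) k c = Sum_any (\<lambda>d. Sum_any (\<lambda>a. g a * h (d - a) * k (c - d)))"
    by (simp add: art_mult_Sum_any Sum_any_mult_right)
  also have "\<dots> = Sum_any (\<lambda>a. Sum_any (\<lambda>d. g a * h (d - a) * k (c - d)))"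
    by (rule Sum_any_swap[OF fin])
  also have "\<dots> = Sum_any (\<lambda>a. Sum_any (\<lambda>b. g a * h b * k (c - (a + b))))"
  proof (rule Sum_any.cong)
    \<comment> \<open>Substitute \<open>d = a + b\<close>.\<close>
    fix a
    show "Sum_any (\<lambda>d. g a * h (d - a) * k (c - d)) = Sum_any (\<lambda>b. g a * h b * k (c - (a + b)))"
      by (subst Sum_any_plus_reindex[of _ a]) simp
  qed
  also have "\<dots> = art_mult g (art_mult h k) c"
    by (simp add: art_mult_Sum_any Sum_any_mult_left mult.assoc diff_diff_eq)
  finally show "art_mult (art_mult g h) k c = art_mult g (art_mult h k) c" .
qed


section \<open>Powers of a delta operator\<close>

locale delta_op =
  fixes n :: int and f :: "'i::log_index \<Rightarrow> complex"
  assumes delta: "delta_operator f"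
begin

abbreviation tail_monoid :: "'i set" where
  "tail_monoid \<equiv> gen_monoid (support (delta_tail f))"

definition tail_pow :: "nat \<Rightarrow> 'i \<Rightarrow> complex" where
  "tail_pow k = (art_mult (delta_tail f) ^^ k) (basis 0)"

text \<open>The binomial series of \<open>(1 + h)^b\<close>. Multiplied by \<open>D^b\<close> and by
  the branch of \<open>c^b\<close> given by \<open>lead_pow\<close>, it yields the power of
  \<open>f\<close>.\<close>

definition tail_binom :: "complex \<Rightarrow> 'i \<Rightarrow> complex" where
  "tail_binom b e = Sum_any (\<lambda>k. (b gchoose k) * tail_pow k e)"

definition lead_pow :: "'i \<Rightarrow> complex" where
  "lead_pow b = complex_of_real (cmod (f 1) powr to_real b) *
     exp (\<i> * to_complex b * complex_of_real (Arg (f 1) + 2 * pi * of_int n))"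

lemma f_1_nonzero: "f 1 \<noteq> 0"
  using delta by (simp add: delta_operator_def has_degree_def)

lemma tail_support_pos: "a \<in> support (delta_tail f) \<Longrightarrow> 0 < a"
proof -
  assume a: "a \<in> support (delta_tail f)"
  then have "f (a + 1) \<noteq> 0" "a \<noteq> 0"
    by (auto simp: delta_tail_def split: if_splits)
  moreover have "\<forall>b<1. f b = 0"
    using delta by (simp add: delta_operator_def has_degree_def)
  ultimately have "\<not> a + 1 < 1"
    by blast
  with \<open>a \<noteq> 0\<close> show "0 < a"
    by (simp add: not_less order_less_le)
qed

lemma artinian_tail: "artinian (delta_tail f)"
proof -
  have "wfp_on ((\<lambda>b. b - 1) ` support f) (<)"
    using delta unfolding wfp_on_image delta_operator_def artinian_def by simp
  moreover have "support (delta_tail f) \<subseteq> (\<lambda>b. b - 1) ` support f"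
  proof
    fix a assume "a \<in> support (delta_tail f)"
    then have "f (a + 1) \<noteq> 0"
      by (auto simp: delta_tail_def split: if_splits)
    then show "a \<in> (\<lambda>b. b - 1) ` support f"
      by (intro image_eqI[of _ _ "a + 1"]) auto
  qed
  ultimately show ?thesis
    unfolding artinian_def by (rule wfp_on_subset)
qed

lemma wfp_on_tail_monoid: "wfp_on tail_monoid (<)"
  by (rule wfp_on_gen_monoid[OF artinian_tail[unfolded artinian_def] tail_support_pos])

lemma tail_monoid_nonneg: "x \<in> tail_monoid \<Longrightarrow> 0 \<le> x"
  by (rule gen_monoid_nonneg[OF tail_support_pos])

lemma support_tail_pow: "support (tail_pow k) \<subseteq> list_sums (support (delta_tail f)) k"
proof (induction k)
  case 0
  then show ?case by (simp add: tail_pow_def support_basis)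
next
  case (Suc k)
  have "support (tail_pow (Suc k)) \<subseteq> support (delta_tail f) + support (tail_pow k)"
    using support_art_mult by (simp add: tail_pow_def)
  also have "\<dots> \<subseteq> list_sums (support (delta_tail f)) (Suc k)"
    unfolding list_sums_Suc by (intro set_plus_mono2 Suc order_refl)
  finally show ?case .
qed

lemma tail_pow_in_monoid: "tail_pow k e \<noteq> 0 \<Longrightarrow> e \<in> tail_monoid"
  using support_tail_pow[of k] unfolding gen_monoid_def by auto

lemma artinian_tail_pow: "artinian (tail_pow k)"
  unfolding artinian_def
  by (rule wfp_on_subset[OF wfp_on_list_sums[OF artinian_tail[unfolded artinian_def]] support_tail_pow])

lemma tail_pow_bound:
  obtains K where "\<And>k. tail_pow k e \<noteq> 0 \<Longrightarrow> k \<le> K"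
proof -
  obtain K where K: "\<And>k x. x \<in> list_sums (support (delta_tail f)) k \<Longrightarrow> x \<le> e \<Longrightarrow> k \<le> K"
    using list_sums_length_bound[OF artinian_tail[unfolded artinian_def]] tail_support_pos by blast
  have "k \<le> K" if "tail_pow k e \<noteq> 0" for k
  proof (rule K)
    show "e \<in> list_sums (support (delta_tail f)) k"
      using that support_tail_pow[of k] by auto
  qed simp
  then show thesis
    by (rule that)
qed

lemma finite_tail_pow: "finite {k. tail_pow k e \<noteq> 0}"
proof -
  obtain K where "\<And>k. tail_pow k e \<noteq> 0 \<Longrightarrow> k \<le> K"
    using tail_pow_bound[of e] by blast
  then have "{k. tail_pow k e \<noteq> 0} \<subseteq> {..K}"
    by auto
  then show ?thesis
    by (rule finite_subset) simp
qed

lemma tail_pow_add: "tail_pow (k + l) = art_mult (tail_pow k) (tail_pow l)"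
proof (induction k)
  case 0
  then show ?case
    by (simp add: tail_pow_def art_mult_basis_left fun_eq_iff)
next
  case (Suc k)
  have "tail_pow (Suc k + l) = art_mult (delta_tail f) (tail_pow (k + l))"
    by (simp add: tail_pow_def)
  also have "\<dots> = art_mult (art_mult (delta_tail f) (tail_pow k)) (tail_pow l)"
    unfolding Suc by (rule art_mult_assoc[symmetric]) (rule artinian_tail artinian_tail_pow)+
  also have "\<dots> = art_mult (tail_pow (Suc k)) (tail_pow l)"
    by (simp add: tail_pow_def)
  finally show ?case .
qed

lemma tail_binom_in_monoid: "tail_binom b e \<noteq> 0 \<Longrightarrow> e \<in> tail_monoid"
  unfolding tail_binom_def
  by (erule Sum_any.not_neutral_obtains_not_neutral) (auto intro: tail_pow_in_monoid)

text \<open>A nonempty sum of positive exponents is positive, so only the term \<open>k = 0\<close>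
  reaches exponent 0.\<close>

lemma tail_binom_zero: "tail_binom b 0 = 1"
proof -
  have "tail_pow k 0 = 0" if "k \<noteq> 0" for k
  proof (rule ccontr)
    assume "tail_pow k 0 \<noteq> 0"
    then have "0 \<in> list_sums (support (delta_tail f)) k"
      using support_tail_pow[of k] by auto
    then obtain xs where xs: "set xs \<subseteq> support (delta_tail f)" "length xs = k" "sum_list xs = 0"
      by (auto simp: list_sums_def)
    then have pos: "\<forall>x\<in>set xs. 0 < x"
      using tail_support_pos by blast
    obtain y ys where "xs = y # ys"
      using xs(2) \<open>k \<noteq> 0\<close> by (cases xs) auto
    moreover have "0 \<le> sum_list ys"
      using pos \<open>xs = y # ys\<close> by (intro sum_list_nonneg less_imp_le) simp
    ultimately have "0 < sum_list xs"
      using pos by (simp add: add_pos_nonneg)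
    with xs(3) show False
      by simp
  qed
  then have "tail_binom b 0 = (b gchoose 0) * tail_pow 0 0"
    unfolding tail_binom_def by (intro Sum_any_single) simp
  then show ?thesis
    by (simp add: tail_pow_def basis_def)
qed

text \<open>Convolving the exponents merges the powers \<open>k\<close> and \<open>l\<close> of
  \<open>h\<close> into the power \<open>k + l\<close>; collecting by \<open>m = k + l\<close>
  leaves the Vandermonde convolution of binomial coefficients.\<close>

lemma tail_binom_add: "art_mult (tail_binom b) (tail_binom c) = tail_binom (b + c)"
proof
  fix e
  let ?F = "\<lambda>d k l. (b gchoose k) * tail_pow k d * ((c gchoose l) * tail_pow l (e - d))"
  let ?G = "\<lambda>k m. if k \<le> m then (b gchoose k) * (c gchoose (m - k)) * tail_pow m e else 0"
  have fin: "finite {(d, k, l). ?F d k l \<noteq> 0}"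
  proof (rule finite_subset)
    show "{(d, k, l). ?F d k l \<noteq> 0} \<subseteq> Sigma {d \<in> tail_monoid. e - d \<in> tail_monoid}
        (\<lambda>d. {k. tail_pow k d \<noteq> 0} \<times> {l. tail_pow l (e - d) \<noteq> 0})"
      by (auto intro: tail_pow_in_monoid)
    show "finite (Sigma {d \<in> tail_monoid. e - d \<in> tail_monoid}
        (\<lambda>d. {k. tail_pow k d \<noteq> 0} \<times> {l. tail_pow l (e - d) \<noteq> 0}))"
      by (intro finite_SigmaI finite_cartesian_product finite_sum_decompositions
          wfp_on_tail_monoid finite_tail_pow)
  qed
  obtain K where K: "\<And>k. tail_pow k e \<noteq> 0 \<Longrightarrow> k \<le> K"
    using tail_pow_bound[of e] by blast
  \<comment> \<open>A nonzero term has \<open>k\<close> at most \<open>m\<close> and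
    \<open>m\<close> at most \<open>K\<close>.\<close>
  have fin': "finite {(k, m). ?G k m \<noteq> 0}"
  proof (rule finite_subset)
    show "{(k, m). ?G k m \<noteq> 0} \<subseteq> {..K} \<times> {..K}"
      using K by (auto split: if_splits intro: le_trans)
  qed simp
  have "art_mult (tail_binom b) (tail_binom c) e = Sum_any (\<lambda>d. Sum_any (\<lambda>k. Sum_any (\<lambda>l. ?F d k l)))"
    by (simp only: art_mult_Sum_any tail_binom_def Sum_any_mult_left Sum_any_mult_right)
  also have "\<dots> = Sum_any (\<lambda>k. Sum_any (\<lambda>l. Sum_any (\<lambda>d. ?F d k l)))"
    by (rule Sum_any_rotate[OF fin])
  also have "\<dots> = Sum_any (\<lambda>k. Sum_any (\<lambda>l. (b gchoose k) * (c gchoose l) * tail_pow (k + l) e))"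
  proof (intro Sum_any.cong)
    fix k l
    have "Sum_any (\<lambda>d. ?F d k l) =
        Sum_any (\<lambda>d. (b gchoose k) * (c gchoose l) * (tail_pow k d * tail_pow l (e - d)))"
      by (simp add: mult_ac)
    also have "\<dots> = (b gchoose k) * (c gchoose l) * tail_pow (k + l) e"
      by (simp only: Sum_any_mult_left tail_pow_add art_mult_Sum_any)
    finally show "Sum_any (\<lambda>d. ?F d k l) = (b gchoose k) * (c gchoose l) * tail_pow (k + l) e" .
  qed
  also have "\<dots> = Sum_any (\<lambda>k. Sum_any (\<lambda>m. ?G k m))"
  proof (rule Sum_any.cong)
    fix k
    show "Sum_any (\<lambda>l. (b gchoose k) * (c gchoose l) * tail_pow (k + l) e) = Sum_any (\<lambda>m. ?G k m)"
      by (subst Sum_any_nat_shift[of _ k]) (simp cong: if_cong)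
  qed
  also have "\<dots> = Sum_any (\<lambda>m. Sum_any (\<lambda>k. ?G k m))"
    by (rule Sum_any_swap[OF fin'])
  also have "\<dots> = Sum_any (\<lambda>m. (b + c gchoose m) * tail_pow m e)"
  proof (rule Sum_any.cong)
    fix m
    have "Sum_any (\<lambda>k. ?G k m) = (\<Sum>k\<in>{0..m}. ?G k m)"
      by (rule Sum_any.expand_superset) auto
    also have "\<dots> = (\<Sum>k\<in>{0..m}. (b gchoose k) * (c gchoose (m - k))) * tail_pow m e"
      by (simp add: sum_distrib_right)
    finally show "Sum_any (\<lambda>k. ?G k m) = (b + c gchoose m) * tail_pow m e"
      by (simp add: gbinomial_Vandermonde)
  qed
  finally show "art_mult (tail_binom b) (tail_binom c) e = tail_binom (b + c) e"
    by (simp add: tail_binom_def)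
qed

lemma lead_pow_nonzero: "lead_pow b \<noteq> 0"
  using f_1_nonzero by (simp add: lead_pow_def)

lemma lead_pow_add: "lead_pow (a + b) = lead_pow a * lead_pow b"
proof -
  have "exp (\<i> * to_complex (a + b) * t) = exp (\<i> * to_complex a * t) * exp (\<i> * to_complex b * t)" for t
    by (simp add: to_real_add ring_distribs flip: exp_add)
  then show ?thesis
    by (simp add: lead_pow_def to_real_add powr_add)
qed

section \<open>The exponent law for powers of a delta operator\<close>

lemma delta_pow_eq: "delta_pow n f b e = lead_pow b * tail_binom (to_complex b) (e - b)"
  by (simp add: delta_pow_def lead_pow_def tail_binom_def tail_pow_def formal_sum_Sum_any)

lemma delta_pow_in_monoid: "delta_pow n f b e \<noteq> 0 \<Longrightarrow> e - b \<in> tail_monoid"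
  using tail_binom_in_monoid by (auto simp: delta_pow_eq)

lemma delta_pow_self_nonzero: "delta_pow n f b b \<noteq> 0"
  by (simp add: delta_pow_eq tail_binom_zero lead_pow_nonzero)

lemma delta_pow_add: "art_mult (delta_pow n f a) (delta_pow n f b) = delta_pow n f (a + b)"
proof
  fix e
  have "art_mult (delta_pow n f a) (delta_pow n f b) e =
      Sum_any (\<lambda>d. lead_pow a * tail_binom (to_complex a) d *
        (lead_pow b * tail_binom (to_complex b) (e - (a + d) - b)))"
    unfolding art_mult_Sum_any delta_pow_eq by (subst Sum_any_plus_reindex[of _ a]) simp
  also have "\<dots> = Sum_any (\<lambda>d. lead_pow a * lead_pow b * (tail_binom (to_complex a) d *
        tail_binom (to_complex b) ((e - (a + b)) - d)))"
    by (simp add: mult_ac diff_diff_eq add_ac)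
  also have "\<dots> = lead_pow a * lead_pow b * art_mult (tail_binom (to_complex a)) (tail_binom (to_complex b)) (e - (a + b))"
    by (simp only: Sum_any_mult_left art_mult_Sum_any)
  finally show "art_mult (delta_pow n f a) (delta_pow n f b) e = delta_pow n f (a + b) e"
    by (simp add: tail_binom_add delta_pow_eq lead_pow_add to_real_add)
qed

subsection \<open>Substituting a delta operator\<close>

lemma delta_subst_Sum_any: "delta_subst n f u e = Sum_any (\<lambda>a. u a * delta_pow n f a e)"
  by (simp add: delta_subst_def formal_sum_Sum_any)

lemma artinian_delta_pow: "artinian (delta_pow n f b)"
proof -
  have "support (delta_pow n f b) \<subseteq> {b} + tail_monoid"
  proof
    fix e assume "e \<in> support (delta_pow n f b)"
    then have "e - b \<in> tail_monoid"
      by (simp add: delta_pow_in_monoid)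
    then show "e \<in> {b} + tail_monoid"
      using set_plus_intro[of b "{b}" "e - b" tail_monoid] by simp
  qed
  moreover have "wfp_on ({b} + tail_monoid) (<)"
    using artinian_basis[of b] unfolding artinian_def support_basis
    by (rule wfp_on_less_plus[OF _ wfp_on_tail_monoid])
  ultimately show ?thesis
    unfolding artinian_def by (rule wfp_on_subset[rotated])
qed

lemma in_support_plus_monoid:
  assumes "u a \<noteq> 0" and "delta_pow n f a e \<noteq> 0"
  shows "e \<in> support u + tail_monoid"
  using set_plus_intro[of a "support u" "e - a" tail_monoid] delta_pow_in_monoid[OF assms(2)] assms(1)
  by simp

lemma finite_delta_subst_terms:
  assumes "artinian u"
  shows "finite {a. u a * delta_pow n f a e \<noteq> 0}"
proof (rule finite_subset)
  show "{a. u a * delta_pow n f a e \<noteq> 0} \<subseteq> {a \<in> support u. e - a \<in> tail_monoid}"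
    by (auto intro: delta_pow_in_monoid)
  show "finite {a \<in> support u. e - a \<in> tail_monoid}"
    by (rule finite_sum_decompositions[OF assms[unfolded artinian_def] wfp_on_tail_monoid])
qed

text \<open>The exponent law \<open>delta_pow_add\<close>, extended bilinearly. The sums may be
  rearranged because, for fixed \<open>e\<close>, well-ordered supports leave finitely many nonzero
  terms.\<close>

lemma delta_subst_mult:
  assumes "artinian u" and "artinian v"
  shows "delta_subst n f (art_mult u v) = art_mult (delta_subst n f u) (delta_subst n f v)"
proof
  fix e
  let ?F = "\<lambda>d a b. u a * delta_pow n f a d * (v b * delta_pow n f b (e - d))"
  let ?G = "\<lambda>a c. u a * v (c - a) * delta_pow n f c e"
  have fin: "finite {(d, a, b). ?F d a b \<noteq> 0}"
  proof (rule finite_subset)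
    show "{(d, a, b). ?F d a b \<noteq> 0} \<subseteq>
        Sigma {d \<in> support u + tail_monoid. e - d \<in> support v + tail_monoid}
          (\<lambda>d. {a. u a * delta_pow n f a d \<noteq> 0} \<times> {b. v b * delta_pow n f b (e - d) \<noteq> 0})"
      by (auto intro: in_support_plus_monoid)
    have "finite {d \<in> support u + tail_monoid. e - d \<in> support v + tail_monoid}"
      using assms unfolding artinian_def
      by (intro finite_sum_decompositions wfp_on_less_plus wfp_on_tail_monoid)
    then show "finite (Sigma {d \<in> support u + tail_monoid. e - d \<in> support v + tail_monoid}
          (\<lambda>d. {a. u a * delta_pow n f a d \<noteq> 0} \<times> {b. v b * delta_pow n f b (e - d) \<noteq> 0}))"
      by (intro finite_SigmaI finite_cartesian_product finite_delta_subst_terms assms)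
  qed
  have fin': "finite {(c, a). ?G a c \<noteq> 0}"
  proof (rule finite_subset)
    show "{(c, a). ?G a c \<noteq> 0} \<subseteq>
        Sigma {c \<in> support u + support v. e - c \<in> tail_monoid} (\<lambda>c. {a \<in> support u. c - a \<in> support v})"
    proof clarsimp
      fix c a assume "u a \<noteq> 0" "v (c - a) \<noteq> 0" "delta_pow n f c e \<noteq> 0"
      then show "c \<in> support u + support v \<and> e - c \<in> tail_monoid"
        using set_plus_intro[of a "support u" "c - a" "support v"] delta_pow_in_monoid by simp
    qed
    show "finite (Sigma {c \<in> support u + support v. e - c \<in> tail_monoid} (\<lambda>c. {a \<in> support u. c - a \<in> support v}))"
      using assms unfolding artinian_def
      by (intro finite_SigmaI finite_sum_decompositions wfp_on_less_plus wfp_on_tail_monoid)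
  qed
  have "art_mult (delta_subst n f u) (delta_subst n f v) e = Sum_any (\<lambda>d. Sum_any (\<lambda>a. Sum_any (\<lambda>b. ?F d a b)))"
    by (simp only: art_mult_Sum_any delta_subst_Sum_any Sum_any_mult_left Sum_any_mult_right)
  also have "\<dots> = Sum_any (\<lambda>a. Sum_any (\<lambda>b. Sum_any (\<lambda>d. ?F d a b)))"
    by (rule Sum_any_rotate[OF fin])
  also have "\<dots> = Sum_any (\<lambda>a. Sum_any (\<lambda>b. u a * v b * delta_pow n f (a + b) e))"
  proof (intro Sum_any.cong)
    fix a b
    have "Sum_any (\<lambda>d. ?F d a b) =
        Sum_any (\<lambda>d. u a * v b * (delta_pow n f a d * delta_pow n f b (e - d)))"
      by (simp add: mult_ac)
    also have "\<dots> = u a * v b * delta_pow n f (a + b) e"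
      by (simp only: Sum_any_mult_left delta_pow_add[symmetric] art_mult_Sum_any)
    finally show "Sum_any (\<lambda>d. ?F d a b) = u a * v b * delta_pow n f (a + b) e" .
  qed
  also have "\<dots> = Sum_any (\<lambda>a. Sum_any (\<lambda>c. ?G a c))"
  proof (rule Sum_any.cong)
    fix a
    show "Sum_any (\<lambda>b. u a * v b * delta_pow n f (a + b) e) = Sum_any (\<lambda>c. ?G a c)"
      by (subst Sum_any_plus_reindex[of "\<lambda>c. ?G a c" a]) simp
  qed
  also have "\<dots> = Sum_any (\<lambda>c. Sum_any (\<lambda>a. ?G a c))"
    by (rule Sum_any_swap[OF fin', symmetric])
  also have "\<dots> = delta_subst n f (art_mult u v) e"
    by (simp only: delta_subst_Sum_any art_mult_Sum_any Sum_any_mult_right)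
  finally show "delta_subst n f (art_mult u v) e = art_mult (delta_subst n f u) (delta_subst n f v) e"
    by simp
qed

text \<open>
  The exponents of \<^term>\<open>delta_pow n f a\<close> lie in \<open>a\<close> plus the monoid generated by the
  support of \<open>h\<close>, so the coefficients of a preimage of \<open>v\<close> can be found by recursion along
  the well-ordered set \<open>support v + tail_monoid\<close>.
\<close>

lemma delta_subst_surj:
  assumes "artinian v"
  obtains u where "artinian u" and "delta_subst n f u = v"
proof -
  define S where "S = support v + tail_monoid"
  \<comment> \<open>The recursion runs along the order of \<open>S\<close>. At \<open>e\<close> the
    step \<open>G\<close> solves the equation for the coefficient of \<open>y^e\<close>, dividing by
    the nonzero diagonal entry \<open>delta_pow n f e e\<close>.\<close>
  define R where "R = {(a, e) \<in> {(a, e). a < e}. a \<in> S \<and> e \<in> S}"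
  define G where "G = (\<lambda>u e. if e \<in> S
    then (v e - Sum_any (\<lambda>a. if (a, e) \<in> R then u a * delta_pow n f a e else 0)) / delta_pow n f e e else 0)"
  define u where "u = wfrec R G"
  have S: "wfp_on S (<)"
    using assms unfolding S_def artinian_def by (intro wfp_on_less_plus wfp_on_tail_monoid)
  have "wf R"
    using S wfp_on_wf_on_eq[of S "{(a, e). a < e}"] wf_on_iff_wf[of S "{(a, e). a < e}"]
    unfolding R_def by (simp only: mem_Collect_eq prod.case)
  moreover have "adm_wf R G"
    unfolding adm_wf_def
  proof (intro allI impI)
    fix g g' :: "'i \<Rightarrow> complex" and e
    assume "\<forall>z. (z, e) \<in> R \<longrightarrow> g z = g' z"
    then have "(\<lambda>a. if (a, e) \<in> R then g a * delta_pow n f a e else 0) =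
        (\<lambda>a. if (a, e) \<in> R then g' a * delta_pow n f a e else 0)"
      by (simp add: fun_eq_iff)
    then show "G g e = G g' e"
      by (simp only: G_def)
  qed
  ultimately have u: "u = G u"
    unfolding u_def by (rule wfrec_fixpoint)
  have supp: "a \<in> S" if "u a \<noteq> 0" for a
  proof (rule ccontr)
    assume "a \<notin> S"
    then have "G u a = 0"
      by (simp add: G_def)
    with u that show False
      by simp
  qed
  have art: "artinian u"
    unfolding artinian_def by (rule wfp_on_subset[OF S]) (auto intro: supp)
  have "delta_subst n f u e = v e" for e
  proof (cases "e \<in> S")
    case True
    let ?T = "\<lambda>a. if (a, e) \<in> R then u a * delta_pow n f a e else 0"
    let ?E = "\<lambda>a. if a = e then u e * delta_pow n f e e else 0"
    \<comment> \<open>The system is triangular: exponents in \<open>tail_monoid\<close> are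
      nonnegative, so a nonzero term has \<open>a\<close> at most \<open>e\<close> and is either a
      recursive or the diagonal term.\<close>
    have split: "u a * delta_pow n f a e = ?T a + ?E a" for a
    proof (cases "u a * delta_pow n f a e = 0 \<or> a = e")
      case True
      then show ?thesis
        by (auto simp: R_def)
    next
      case False
      then have "a \<in> S" "delta_pow n f a e \<noteq> 0" "a \<noteq> e"
        using supp by auto
      moreover from this have "0 \<le> e - a"
        by (intro tail_monoid_nonneg delta_pow_in_monoid)
      ultimately have "(a, e) \<in> R"
        using \<open>e \<in> S\<close> by (simp add: R_def order_less_le)
      with \<open>a \<noteq> e\<close> show ?thesis
        by simp
    qed
    have finT: "finite {a. ?T a \<noteq> 0}"
      by (rule finite_subset[OF _ finite_delta_subst_terms[OF art, of e]]) auto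
    have finE: "finite {a. ?E a \<noteq> 0}"
      by (rule finite_subset[of _ "{e}"]) auto
    have "delta_subst n f u e = Sum_any (\<lambda>a. ?T a + ?E a)"
      unfolding delta_subst_Sum_any by (rule Sum_any.cong) (rule split)
    also have "\<dots> = Sum_any ?T + u e * delta_pow n f e e"
      unfolding Sum_any.distrib[OF finT finE] by (simp only: Sum_any.delta)
    also have "u e * delta_pow n f e e = v e - Sum_any ?T"
      by (subst u) (simp add: G_def True delta_pow_self_nonzero del: Sum_any.cong)
    finally show ?thesis
      by simp
  next
    case False
    \<comment> \<open>Outside \<open>S\<close> both sides vanish, because \<open>S\<close> contains
      the support of \<open>v\<close> and is closed under adding elements of
      \<open>tail_monoid\<close>.\<close>
    have "v e = 0"
      using False set_plus_intro[of e "support v" 0 tail_monoid] zero_in_gen_monoid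
      by (auto simp: S_def)
    moreover have "u a * delta_pow n f a e = 0" for a
    proof (rule ccontr)
      assume "u a * delta_pow n f a e \<noteq> 0"
      then have "a \<in> S" and m: "e - a \<in> tail_monoid"
        using supp delta_pow_in_monoid by auto
      then obtain s m' where s: "s \<in> support v" "m' \<in> tail_monoid" "a = s + m'"
        unfolding S_def by (elim set_plus_elim)
      have "s + (m' + (e - a)) = e"
        using s(3) by simp
      then have "e \<in> S"
        using set_plus_intro[OF s(1) gen_monoid_add[OF s(2) m]] by (simp only: S_def)
      with False show False ..
    qed
    ultimately show ?thesis
      by (simp only: delta_subst_Sum_any Sum_any.neutral)
  qed
  then have "delta_subst n f u = v"
    by (rule ext)
  with art show thesis
    by (rule that)
qed

text \<open>By surjectivity, \<open>inv_into\<close> returns a genuine Artinian preimage and not an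
  arbitrary default.\<close>

lemma subst_inverse:
  assumes "artinian v"
  shows "artinian (subst_inverse n f v)" and "delta_subst n f (subst_inverse n f v) = v"
proof -
  have "v \<in> delta_subst n f ` {u. artinian u}"
    using delta_subst_surj[OF assms] by blast
  then show "artinian (subst_inverse n f v)" "delta_subst n f (subst_inverse n f v) = v"
    unfolding subst_inverse_def using inv_into_into[of v "delta_subst n f" "{u. artinian u}"]
    by (simp_all add: f_inv_into_f)
qed

text \<open>The pairing commutes with the infinite combination of powers of \<open>f\<close>: the
  exponents \<open>e\<close> that occur are well-ordered by one support and reverse well-ordered by
  the other, hence finite in number.\<close>

lemma delta_subst_pairing:
  assumes "artinian u" and "wfp_on (support P) (>)"
  shows "Sum_any (\<lambda>e. delta_subst n f u e * P e) =
    Sum_any (\<lambda>a. u a * Sum_any (\<lambda>e. delta_pow n f a e * P e))"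
proof -
  have fin: "finite {(e, a). u a * delta_pow n f a e * P e \<noteq> 0}"
  proof (rule finite_subset)
    show "{(e, a). u a * delta_pow n f a e * P e \<noteq> 0} \<subseteq>
        Sigma ((support u + tail_monoid) \<inter> support P) (\<lambda>e. {a. u a * delta_pow n f a e \<noteq> 0})"
      by (auto intro: in_support_plus_monoid)
    have "wfp_on (support u + tail_monoid) (<)"
      using assms(1) unfolding artinian_def by (intro wfp_on_less_plus wfp_on_tail_monoid)
    then have "finite ((support u + tail_monoid) \<inter> support P)"
      by (rule finite_if_wfp_on_less_greater[OF wfp_on_subset wfp_on_subset[OF assms(2)]]) auto
    then show "finite (Sigma ((support u + tail_monoid) \<inter> support P) (\<lambda>e. {a. u a * delta_pow n f a e \<noteq> 0}))"
      by (intro finite_SigmaI finite_delta_subst_terms assms(1))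
  qed
  have "Sum_any (\<lambda>e. delta_subst n f u e * P e) = Sum_any (\<lambda>e. Sum_any (\<lambda>a. u a * delta_pow n f a e * P e))"
    by (simp only: delta_subst_Sum_any Sum_any_mult_right)
  also have "\<dots> = Sum_any (\<lambda>a. Sum_any (\<lambda>e. u a * delta_pow n f a e * P e))"
    by (rule Sum_any_swap[OF fin])
  also have "\<dots> = Sum_any (\<lambda>a. u a * Sum_any (\<lambda>e. delta_pow n f a e * P e))"
    by (simp only: mult.assoc Sum_any_mult_left)
  finally show ?thesis .
qed

text \<open>
  A functional dual to the powers of \<open>f\<close> reads off the coefficients of the preimage under
  the substitution; here it is applied to \<open>g(D) D\<^sup>e\<close>, whose preimage is a product by
  multiplicativity.
\<close>

lemma subst_inverse_shift_pairing:
  assumes "artinian g" and "wfp_on (support P) (>)"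
    and dual: "\<And>a. Sum_any (\<lambda>e. delta_pow n f a e * P e) = (if a = b then 1 else 0)"
  shows "Sum_any (\<lambda>d. g d * P (e + d)) = art_mult (subst_inverse n f g) (inverse_pow n f e) b"
proof -
  let ?w = "art_mult (subst_inverse n f g) (inverse_pow n f e)"
  have w: "artinian ?w"
    unfolding inverse_pow_def by (intro artinian_art_mult subst_inverse artinian_basis assms(1))
  \<comment> \<open>\<open>?w\<close> is a product of preimages of \<open>g\<close> and
    \<open>D^e\<close>, so by multiplicativity it is a preimage of \<open>g(D) D^e\<close>.\<close>
  have "delta_subst n f ?w = art_mult g (basis e)"
    unfolding inverse_pow_def
    by (simp add: delta_subst_mult subst_inverse artinian_basis assms(1))
  then have "Sum_any (\<lambda>x. g (x - e) * P x) = Sum_any (\<lambda>x. delta_subst n f ?w x * P x)"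
    by (simp add: art_mult_basis_right)
  also have "\<dots> = Sum_any (\<lambda>a. ?w a * (if a = b then 1 else 0))"
    unfolding delta_subst_pairing[OF w assms(2)] dual ..
  also have "\<dots> = ?w b * (if b = b then 1 else 0)"
    by (rule Sum_any_single) simp
  finally have "Sum_any (\<lambda>x. g (x - e) * P x) = ?w b"
    by simp
  then show ?thesis
    by (subst (asm) Sum_any_plus_reindex[of _ e]) simp
qed

end


section \<open>Harmonic logarithms\<close>

lemma D_mono_nonzero_fst: "D_mono (a, \<alpha>) (e, \<gamma>) \<noteq> 0 \<Longrightarrow> e = a - 1"
  by (rule ccontr) (simp add: D_mono_def basis_def)

lemma xD_Sum_any: "xD p (e, \<gamma>) = Sum_any (\<lambda>m. p m * D_mono m (e - 1, \<gamma>))"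
  by (simp add: xD_def mult_x_def log_D_def formal_sum_Sum_any)

text \<open>Differentiation lowers the exponent of \<open>x\<close> by one and the factor
  \<open>x\<close> restores it.\<close>

lemma xD_pow_basis_nonzero_fst: "(xD ^^ k) (basis (0, \<alpha>)) (e, \<gamma>) \<noteq> 0 \<Longrightarrow> e = 0"
proof (induction k arbitrary: e \<gamma>)
  case 0
  then show ?case
    by (simp add: basis_def split: if_splits)
next
  case (Suc k)
  then have "Sum_any (\<lambda>m. (xD ^^ k) (basis (0, \<alpha>)) m * D_mono m (e - 1, \<gamma>)) \<noteq> 0"
    by (simp add: xD_Sum_any)
  then obtain m where m: "(xD ^^ k) (basis (0, \<alpha>)) m * D_mono m (e - 1, \<gamma>) \<noteq> 0"
    by (rule Sum_any.not_neutral_obtains_not_neutral)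
  obtain a \<beta> where [simp]: "m = (a, \<beta>)"
    by (cases m)
  have "a = 0"
    using m Suc.IH[of a \<beta>] by simp
  moreover have "e - 1 = a - 1"
    using m by (intro D_mono_nonzero_fst[of a \<beta> _ \<gamma>]) simp
  ultimately show ?case
    by simp
qed

lemma harm_log_Sum_any:
  "harm_log a \<alpha> (e, \<gamma>) =
     roman_fact a * Sum_any (\<lambda>k. harm_coeff a k * (xD ^^ k) (basis (0, \<alpha>)) (e - a, \<gamma>))"
  by (simp add: harm_log_def mult_x_def formal_sum_Sum_any)

lemma harm_log_nonzero_fst:
  assumes "harm_log a \<alpha> (e, \<gamma>) \<noteq> 0"
  shows "e = a"
proof -
  have "Sum_any (\<lambda>k. harm_coeff a k * (xD ^^ k) (basis (0, \<alpha>)) (e - a, \<gamma>)) \<noteq> 0"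
    using assms unfolding harm_log_Sum_any by simp
  then obtain k where "harm_coeff a k * (xD ^^ k) (basis (0, \<alpha>)) (e - a, \<gamma>) \<noteq> 0"
    by (rule Sum_any.not_neutral_obtains_not_neutral)
  then have "e - a = 0"
    by (intro xD_pow_basis_nonzero_fst[of k \<alpha> _ \<gamma>]) simp
  then show ?thesis
    by simp
qed

text \<open>Distinct harmonic logarithms with the same \<open>\<alpha>\<close> have disjoint supports.\<close>

lemma Sum_any_harm_log:
  assumes "h i = e" and "\<And>a. a \<noteq> i \<Longrightarrow> h a \<noteq> e"
  shows "Sum_any (\<lambda>a. c a * harm_log (h a) \<alpha> (e, \<gamma>)) = c i * harm_log e \<alpha> (e, \<gamma>)"
proof -
  have "Sum_any (\<lambda>a. c a * harm_log (h a) \<alpha> (e, \<gamma>)) = c i * harm_log (h i) \<alpha> (e, \<gamma>)"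
  proof (rule Sum_any_single)
    fix a assume "a \<noteq> i"
    then have "h a \<noteq> e"
      by (rule assms(2))
    then have "harm_log (h a) \<alpha> (e, \<gamma>) = 0"
      using harm_log_nonzero_fst[of "h a" \<alpha> e \<gamma>] by metis
    then show "c a * harm_log (h a) \<alpha> (e, \<gamma>) = 0"
      by simp
  qed
  then show ?thesis
    by (simp only: assms(1))
qed

lemma harm_comb_eq: "harm_comb \<alpha> c (e, \<gamma>) = c e * harm_log e \<alpha> (e, \<gamma>)"
  unfolding harm_comb_def formal_sum_Sum_any
  by (rule Sum_any_harm_log) simp_all

text \<open>The poles of \<open>Gamma (a + 1)\<close> fall into the first branch of
  \<open>roman_fact\<close>, so the second branch is never 0.\<close>

lemma to_complex_plus_1_nonpos_Ints:
  assumes "to_complex a + 1 \<in> \<int>\<^sub>\<le>\<^sub>0"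
  shows "to_real a \<in> \<int> \<and> to_real a < 0"
proof -
  obtain N where "to_complex a + 1 = - of_nat N"
    using assms by (elim nonpos_Ints_cases')
  then have "Re (to_complex a + 1) = Re (- of_nat N)"
    by simp
  then have *: "to_real a = - real N - 1"
    by simp
  then have "to_real a = of_int (- int N - 1)"
    by simp
  then have "to_real a \<in> \<int>"
    by (simp only: Ints_of_int)
  with * show ?thesis
    by simp
qed

lemma roman_fact_nonzero: "roman_fact a \<noteq> 0"
  using to_complex_plus_1_nonpos_Ints[of a] Gamma_nonzero[of "to_complex a + 1"]
  by (auto simp: roman_fact_def)

lemma roman_fact_0: "roman_fact 0 = 1"
  by (simp add: roman_fact_def)

lemma harm_coeff_0: "harm_coeff a 0 = rGamma (to_complex a + 1)"
  by (simp add: harm_coeff_def fps_expansion_def)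

text \<open>The zeros of \<open>1 / \<Gamma>\<close> are simple.\<close>

lemma harm_coeff_1_nonzero:
  assumes "harm_coeff a 0 = 0"
  shows "harm_coeff a 1 \<noteq> 0"
proof -
  let ?A = "to_complex a + 1"
  have "?A \<in> \<int>\<^sub>\<le>\<^sub>0"
    using assms rGamma_nonzero by (auto simp: harm_coeff_0)
  then obtain N where N: "?A = - of_nat N"
    by (elim nonpos_Ints_cases')
  have "(Gamma has_field_derivative Gamma 1 * Digamma 1) (at (0 + 1 :: complex))"
    using has_field_derivative_Gamma[of "1::complex" UNIV] by simp
  then have G: "((\<lambda>s::complex. Gamma (s + 1)) has_field_derivative Gamma 1 * Digamma 1) (at 0)"
    by (simp only: DERIV_shift)
  have "(rGamma has_field_derivative (- 1) ^ N * fact N) (at (0 + ?A))"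
    using has_field_derivative_rGamma_nonpos_int[of N UNIV] by (simp add: N)
  then have "((\<lambda>s. rGamma (s + ?A)) has_field_derivative (- 1) ^ N * fact N) (at 0)"
    by (simp only: DERIV_shift)
  then have "((\<lambda>s. rGamma (s + to_complex a + 1)) has_field_derivative (- 1) ^ N * fact N) (at 0)"
    by (simp add: add.assoc)
  \<comment> \<open>The summand of the product rule that contains \<open>rGamma ?A\<close> vanishes
    by assumption; the other has the factor \<open>Gamma 1 = 1\<close>.\<close>
  from DERIV_imp_deriv[OF DERIV_mult[OF G this]]
  have "harm_coeff a 1 = (- 1) ^ N * fact N"
    using assms by (simp add: harm_coeff_def fps_expansion_def)
  then show ?thesis
    by simp
qed


subsection \<open>Coordinates with respect to the harmonic logarithms of \<open>\<alpha> = (1)\<close>\<close>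

text \<open>
  The exponent vector of \<open>log x\<close>, on which \<open>xD\<close> is nilpotent.
\<close>

definition log_exponent :: "nat \<Rightarrow>\<^sub>0 'i::log_index" where
  "log_exponent = Poly_Mapping.single 0 1"

lemma log_exponent_nonzero: "log_exponent \<noteq> 0"
  by (simp add: log_exponent_def)

lemma xD_basis:
  fixes \<alpha> :: "nat \<Rightarrow>\<^sub>0 'i::log_index"
  shows "xD (basis (0, \<alpha>)) (e, \<gamma>) = D_mono (0, \<alpha>) (e - 1, \<gamma>)"
proof -
  have "xD (basis (0, \<alpha>)) (e, \<gamma>) = basis (0 :: 'i, \<alpha>) (0, \<alpha>) * D_mono (0, \<alpha>) (e - 1, \<gamma>)"
    unfolding xD_Sum_any by (rule Sum_any_single) (simp add: basis_def)
  then show ?thesis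
    by (simp add: basis_def)
qed

text \<open>Applying \<open>xD\<close> sends \<open>log x\<close> to 1 and 1 to 0, so only two terms
  of the series defining the harmonic logarithm survive.\<close>

lemma xD_pow_basis_log_exponent:
  "(xD ^^ k) (basis (0, log_exponent)) =
     (if k = 0 then basis (0, log_exponent) else if k = 1 then basis (0, 0) else (\<lambda>_. 0))"
proof (induction k)
  case (Suc k)
  have "xD (basis (0, log_exponent)) = basis (0, 0 :: nat \<Rightarrow>\<^sub>0 'a)"
  proof
    fix m :: "'a log_mono"
    obtain e \<gamma> where m: "m = (e, \<gamma>)"
      by (cases m)
    show "xD (basis (0, log_exponent)) m = basis (0, 0) m"
      unfolding m xD_basis
      by (simp add: D_mono_def log_exponent_def log_shift_def basis_def to_real_one del: single_one)
  qed
  moreover have "xD (basis (0, 0 :: nat \<Rightarrow>\<^sub>0 'a)) = (\<lambda>_. 0)"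
  proof
    fix m :: "'a log_mono"
    show "xD (basis (0, 0)) m = 0"
      by (cases m) (simp add: xD_basis D_mono_def)
  qed
  moreover have "xD (\<lambda>_. 0) = (\<lambda>_ :: 'a log_mono. 0)"
  proof
    fix m :: "'a log_mono"
    show "xD (\<lambda>_. 0) m = 0"
      by (cases m) (simp add: xD_Sum_any)
  qed
  ultimately show ?case
    using Suc by simp
qed simp

text \<open>The harmonic logarithm is the Roman factorial times
  \<open>x^a (c_0 log x + c_1)\<close>, and \<open>c_0\<close>, \<open>c_1\<close> cannot both
  vanish since zeros of \<open>1 / Gamma\<close> are simple.\<close>

lemma harm_log_log_exponent_nonzero: "\<exists>\<gamma>. harm_log a log_exponent (a, \<gamma>) \<noteq> 0"
proof -
  have "harm_log a log_exponent (a, log_exponent) = roman_fact a * (harm_coeff a 0 *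
      (xD ^^ 0) (basis (0, log_exponent)) (a - a, log_exponent))"
    unfolding harm_log_Sum_any xD_pow_basis_log_exponent
    by (subst Sum_any_single[of 0]) (auto simp: basis_def log_exponent_nonzero)
  then have 0: "harm_log a log_exponent (a, log_exponent) = roman_fact a * harm_coeff a 0"
    by (simp add: basis_def)
  have "harm_log a log_exponent (a, 0) = roman_fact a * (harm_coeff a 1 *
      (xD ^^ 1) (basis (0, log_exponent)) (a - a, 0))"
    unfolding harm_log_Sum_any xD_pow_basis_log_exponent
    by (subst Sum_any_single[of 1]) (auto simp: basis_def log_exponent_nonzero[symmetric])
  then have 1: "harm_log a log_exponent (a, 0) = roman_fact a * harm_coeff a 1"
    unfolding xD_pow_basis_log_exponent by (simp add: basis_def)
  show ?thesis
  proof (cases "harm_coeff a 0 = 0")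
    case True
    then show ?thesis
      using 1 harm_coeff_1_nonzero[of a] roman_fact_nonzero[of a] by (intro exI[of _ 0]) simp
  next
    case False
    then show ?thesis
      using 0 roman_fact_nonzero[of a] by (intro exI[of _ log_exponent]) simp
  qed
qed

text \<open>Each coefficient can be read off at its own power of \<open>x\<close>, where the
  harmonic logarithm is nonzero. Hence \<open>harm_comb\<close> is injective and
  \<open>inv_into\<close> a true inverse.\<close>

lemma harm_coords_harm_comb:
  assumes "rev_artinian c"
  shows "harm_coords log_exponent (harm_comb log_exponent c) = c"
proof -
  have "inj (harm_comb (log_exponent :: nat \<Rightarrow>\<^sub>0 'a))"
  proof (rule injI)
    fix c d :: "'a \<Rightarrow> complex"
    assume eq: "harm_comb log_exponent c = harm_comb log_exponent d"
    show "c = d"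
    proof
      fix a :: 'a
      obtain \<gamma> where "harm_log a log_exponent (a, \<gamma>) \<noteq> 0"
        using harm_log_log_exponent_nonzero by blast
      then show "c a = d a"
        using fun_cong[OF eq, of "(a, \<gamma>)"] by (simp add: harm_comb_eq)
    qed
  qed
  then have "inj_on (harm_comb log_exponent) {c :: 'a \<Rightarrow> complex. rev_artinian c}"
    by (rule inj_on_subset) simp
  then show ?thesis
    unfolding harm_coords_def using assms by (simp add: inv_into_f_f)
qed

section \<open>Artinian operators in coordinates\<close>

definition op_coords :: "('i::log_index \<Rightarrow> complex) \<Rightarrow> ('i \<Rightarrow> complex) \<Rightarrow> 'i \<Rightarrow> complex" where
  "op_coords g c e = Sum_any (\<lambda>b. g b * (c (e + b) * (roman_fact (e + b) / roman_fact e)))"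

lemma op_apply_harm_comb:
  assumes "rev_artinian c"
  shows "op_apply log_exponent g (harm_comb log_exponent c) = harm_comb log_exponent (op_coords g c)"
proof
  fix m :: "'a log_mono"
  obtain e \<gamma> where m: "m = (e, \<gamma>)"
    by (cases m)
  let ?l = "harm_log e log_exponent (e, \<gamma>)"
  \<comment> \<open>The only harmonic logarithm that \<open>D^b\<close> lowers to index
    \<open>e\<close> is the one with index \<open>e + b\<close>.\<close>
  have D: "D_pow log_exponent b (harm_comb log_exponent c) (e, \<gamma>) =
      c (e + b) * (roman_fact (e + b) / roman_fact e) * ?l" for b
    unfolding D_pow_def formal_sum_Sum_any harm_coords_harm_comb[OF assms] mult.assoc[symmetric]
    by (subst Sum_any_harm_log[of "\<lambda>a. a - b" "e + b" e]) auto
  show "op_apply log_exponent g (harm_comb log_exponent c) m =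
      harm_comb log_exponent (op_coords g c) m"
    unfolding m op_apply_def formal_sum_Sum_any D harm_comb_eq op_coords_def
    by (simp only: mult.assoc[symmetric] Sum_any_mult_right)
qed

text \<open>Negation turns reverse well-ordered into well-ordered sets. Then
  \<open>- e = b + (- (e + b))\<close> exhibits each negated exponent in a sum of two well-ordered
  sets.\<close>

lemma rev_artinian_op_coords:
  assumes "artinian g" and "rev_artinian c"
  shows "rev_artinian (op_coords g c)"
proof -
  have "wfp_on (support g + uminus ` support c) (<)"
    using assms unfolding artinian_def rev_artinian_def wfp_on_greater_uminus
    by (intro wfp_on_less_plus)
  moreover have "uminus ` support (op_coords g c) \<subseteq> support g + uminus ` support c"
  proof clarsimp
    fix e assume "op_coords g c e \<noteq> 0"
    then obtain b where "g b * (c (e + b) * (roman_fact (e + b) / roman_fact e)) \<noteq> 0"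
      unfolding op_coords_def by (rule Sum_any.not_neutral_obtains_not_neutral)
    then have "b \<in> support g" "e + b \<in> support c"
      by auto
    from set_plus_intro[OF this(1) imageI[OF this(2), of uminus]] show "- e \<in> support g + uminus ` support c"
      by simp
  qed
  ultimately show ?thesis
    unfolding rev_artinian_def wfp_on_greater_uminus by (rule wfp_on_subset)
qed

lemma log_bracket_op_apply:
  assumes "artinian g" and "rev_artinian c"
  shows "log_bracket log_exponent (op_apply log_exponent g (harm_comb log_exponent c)) =
    Sum_any (\<lambda>e. g e * (roman_fact e * c e))"
  unfolding log_bracket_def op_apply_harm_comb[OF assms(2)]
    harm_coords_harm_comb[OF rev_artinian_op_coords[OF assms]] op_coords_def
  by (rule Sum_any.cong) (simp add: roman_fact_0)


section \<open>Sheffer sequences\<close>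

text \<open>The generating function identity at one monomial: the power of \<open>x\<close> selects
  the harmonic logarithm \<open>e\<close>, and \<open>b\<close> selects the power of
  \<open>y\<close>.\<close>

lemma sheffer_coords:
  fixes f g :: "'i::log_index \<Rightarrow> complex"
  assumes "delta_operator f" and g: "artinian g" and s: "graded_sequence s" and "sheffer n f g s"
  shows "s b \<beta> (e, \<gamma>) = roman_fact b * (harm_log e \<beta> (e, \<gamma>) / roman_fact e *
    art_mult (subst_inverse n f g) (inverse_pow n f e) b)"
proof -
  interpret delta_op n f
    by standard (rule assms(1))
  obtain p where p: "associated n f p"
    and sp: "\<And>a \<alpha>. \<alpha> \<noteq> 0 \<Longrightarrow> s a \<alpha> = op_apply \<alpha> g (p a \<alpha>)"
    using assms(4) unfolding sheffer_def by blast
  have "p b log_exponent \<in> log_space log_exponent"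
    using p by (simp add: associated_def graded_sequence_def)
  then obtain c where c: "rev_artinian c" and pb: "p b log_exponent = harm_comb log_exponent c"
    unfolding log_space_def by blast
  have sb: "s b log_exponent = harm_comb log_exponent (op_coords g c)"
    using sp[OF log_exponent_nonzero] by (simp only: pb op_apply_harm_comb[OF c])
  \<comment> \<open>Pairing an operator with \<open>P\<close> is its bracket with
    \<open>p b\<close>, divided by the Roman factorial of \<open>b\<close> so that duality to the
    powers of \<open>f\<close> becomes a plain Kronecker delta.\<close>
  define P where "P = (\<lambda>e. roman_fact e * c e / roman_fact b)"
  have P: "wfp_on (support P) (>)"
    using c unfolding rev_artinian_def by (rule wfp_on_subset) (auto simp: P_def)
  have dual: "Sum_any (\<lambda>e. delta_pow n f a e * P e) = (if a = b then 1 else 0)" for a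
  proof -
    have "Sum_any (\<lambda>e. delta_pow n f a e * P e) =
        Sum_any (\<lambda>e. delta_pow n f a e * (roman_fact e * c e) * (1 / roman_fact b))"
      by (simp add: P_def)
    also have "\<dots> = log_bracket log_exponent
        (op_apply log_exponent (delta_pow n f a) (p b log_exponent)) * (1 / roman_fact b)"
      unfolding pb log_bracket_op_apply[OF artinian_delta_pow c] by (rule Sum_any_mult_right)
    also have "log_bracket log_exponent (op_apply log_exponent (delta_pow n f a) (p b log_exponent)) =
        (if b = a then roman_fact b else 0)"
      using p log_exponent_nonzero unfolding associated_def by blast
    finally show ?thesis
      by (simp add: roman_fact_nonzero)
  qed
  have "op_coords g c e = Sum_any (\<lambda>d. roman_fact b / roman_fact e * (g d * P (e + d)))"
    unfolding op_coords_def by (rule Sum_any.cong) (simp add: P_def roman_fact_nonzero)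
  also have "\<dots> = roman_fact b / roman_fact e * art_mult (subst_inverse n f g) (inverse_pow n f e) b"
    unfolding Sum_any_mult_left subst_inverse_shift_pairing[OF g P dual] ..
  finally have coords: "op_coords g c e = \<dots>" .
  \<comment> \<open>Regularity carries the coordinates found at \<open>log_exponent\<close> over to
    every \<beta>, zero included.\<close>
  have "s b \<beta> = harm_comb \<beta> (harm_coords log_exponent (s b log_exponent))"
    using s log_exponent_nonzero unfolding graded_sequence_def regular_def by blast
  then have "s b \<beta> (e, \<gamma>) = op_coords g c e * harm_log e \<beta> (e, \<gamma>)"
    by (simp only: sb harm_coords_harm_comb[OF rev_artinian_op_coords[OF g c]] harm_comb_eq)
  then show ?thesis
    by (simp add: coords)
qed

lemma sheffer_generating_function:
  fixes f g :: "'i::log_index \<Rightarrow> complex"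
  assumes "delta_operator f" and "artinian g" and s: "graded_sequence s" and "sheffer n f g s"
  shows "y_summable (\<lambda>a. y_mult (subst_inverse n f g) (exp_summand n f \<alpha> a)) \<and>
    sequence_gf s \<alpha> = y_sum (\<lambda>a. y_mult (subst_inverse n f g) (exp_summand n f \<alpha> a))"
proof -
  let ?F = "\<lambda>a. y_mult (subst_inverse n f g) (exp_summand n f \<alpha> a)"
  have F: "?F a b m = art_mult (subst_inverse n f g) (inverse_pow n f a) b / roman_fact a * harm_log a \<alpha> m"
    for a b m
  proof -
    have "?F a b m = Sum_any (\<lambda>c. harm_log a \<alpha> m / roman_fact a *
        (subst_inverse n f g c * inverse_pow n f a (b - c)))"
      by (simp add: y_mult_def exp_summand_def art_mult_Sum_any mult_ac)
    also have "\<dots> = harm_log a \<alpha> m / roman_fact a * art_mult (subst_inverse n f g) (inverse_pow n f a) b"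
      by (simp only: Sum_any_mult_left art_mult_Sum_any)
    finally show ?thesis
      by simp
  qed
  \<comment> \<open>At a given monomial the only summand that can contribute is the one indexed by
    the exponent of \<open>x\<close>, and there it already equals the left-hand side.\<close>
  have diag: "?F e b (e, \<gamma>) = s b \<alpha> (e, \<gamma>) / roman_fact b" for b e \<gamma>
    by (simp add: F sheffer_coords[OF assms] roman_fact_nonzero)
  have off_diag: "?F a b m = 0" if "a \<noteq> fst m" for a b m
    using that harm_log_nonzero_fst[of a \<alpha> "fst m" "snd m"] by (auto simp: F)
  have "log_summable (\<lambda>a. ?F a b)" for b
    unfolding log_summable_def
  proof (intro conjI allI)
    have "wfp_on (support (s b \<alpha>)) (\<lambda>m m'. log_mono_less m' m)"
      using s by (simp add: graded_sequence_def log_space_def log_algebra_def)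
    moreover have "(\<Union>a. support (?F a b)) \<subseteq> support (s b \<alpha>)"
    proof
      fix m assume "m \<in> (\<Union>a. support (?F a b))"
      then obtain a where "?F a b m \<noteq> 0"
        by auto
      moreover from this have "a = fst m"
        using off_diag by blast
      ultimately show "m \<in> support (s b \<alpha>)"
        using diag[of "fst m" b "snd m"] by auto
    qed
    ultimately show "wfp_on (\<Union>a. support (?F a b)) (\<lambda>m m'. log_mono_less m' m)"
      by (rule wfp_on_subset)
  next
    fix m
    show "finite {a. ?F a b m \<noteq> 0}"
      by (rule finite_subset[of _ "{fst m}"]) (use off_diag in blast, simp)
  qed
  moreover have "sequence_gf s \<alpha> b m = y_sum ?F b m" for b m
  proof -
    have "y_sum ?F b m = ?F (fst m) b m"
      unfolding y_sum_def formal_sum_Sum_any by (rule Sum_any_single) (rule off_diag)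
    then show ?thesis
      using diag[of "fst m" b "snd m"] by (simp add: sequence_gf_def)
  qed
  ultimately show ?thesis
    by (auto simp: y_summable_def fun_eq_iff)
qed

theorem theorem4p3:
  shows "(\<forall>(n::int) (f::int \<Rightarrow> complex) (g::int \<Rightarrow> complex) (s::int log_sequence).
            delta_operator f \<and> artinian g \<and> has_degree g 0 \<and> graded_sequence s \<and>
            sheffer n f g s \<longrightarrow>
            (\<forall>\<alpha>.
              y_summable (\<lambda>k. y_mult (subst_inverse n f g) (exp_summand n f \<alpha> k)) \<and>
              sequence_gf s \<alpha> =
                y_sum (\<lambda>k. y_mult (subst_inverse n f g) (exp_summand n f \<alpha> k))))
       \<and> (\<forall>(n::int) (f::real \<Rightarrow> complex) (g::real \<Rightarrow> complex) (s::real log_sequence).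
            delta_operator f \<and> artinian g \<and> has_degree g 0 \<and> graded_sequence s \<and>
            sheffer n f g s \<longrightarrow>
            (\<forall>\<alpha>.
              y_summable (\<lambda>a. y_mult (subst_inverse n f g) (exp_summand n f \<alpha> a)) \<and>
              sequence_gf s \<alpha> =
                y_sum (\<lambda>a. y_mult (subst_inverse n f g) (exp_summand n f \<alpha> a))))"
  \<comment> \<open>The discrete and the continuous case are the instances of one lemma at the index
    types \<open>int\<close> and \<open>real\<close>.\<close>
  by (rule conjI; intro allI impI sheffer_generating_function; elim conjE; assumption)

end
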